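(* Let $q\in\mathbb{C}$ be a primitive cube root of unity ($r=3$) and let $\mathrm{Max}=\delta\mathrm{d}:\Omega^1\to\Omega^1$ be the Maxwell operator on the reduced quantum group $\mathcal{A}=\mathbb{C}_q[SL_2]$. A basis of the valid sources in the direction of $\theta$, i.e. of the space of 1-forms $\theta f$, $f\in\mathcal{A}$, lying in the image of $\mathrm{Max}$, is provided by $$\theta,\ \theta a,\ \theta b,\ \theta c,\ \theta d.$$ In particular, $\theta$ is a valid source and has a gauge field, i.e. a 1-form $A$ with $\mathrm{Max}(A)=\theta$ (not uniquely determined, since any element of $\ker\mathrm{Max}$ can be added), given in Lorentz gauge (i.e. with $\delta A=0$) by $$A=-\frac{q^2}{12}\,\theta\,bc(1+bc)-\frac{q\mu}{12}\,(e_a+e_c\,a^2c).$$ Its curvature $F=\mathrm{d}A$ is $$F=\frac q4\,e_{ad}-\frac{\mu}{12}\left((e_{ab}-e_{bd})\,d^2b+q\,(e_{cd}-e_{ac})\,a^2c\right).$$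
   Context: Here $q^3=1$, $q\ne1$, $\mu=1-q^{-2}$. $\mathcal{A}$ is the unital $\mathbb{C}$-algebra generated by $a,b,c,d$ with relations $ba=qab$, $ca=qac$, $db=qbd$, $dc=qcd$, $cb=bc$, $da-ad=q\mu bc$, $ad-q^{-1}bc=1$, $a^3=d^3=1$, $b^3=c^3=0$. It has dimension 27 with basis $\{a^mb^nc^k\}_{0\le m,n,k\le2}$. $\Lambda$ is the graded algebra generated by degree-1 elements $e_a,e_b,e_c,e_d$ with relations: $e_b,e_c,e_d$ pairwise anticommute and square to zero; $e_a\wedge e_a=\mu e_b\wedge e_c$; $e_a\wedge e_d+e_d\wedge e_a+\mu e_b\wedge e_c=0$; $e_a\wedge e_b+q^2e_b\wedge e_a-\mu e_b\wedge e_d=0$; $e_c\wedge e_a+q^2e_a\wedge e_c+\mu e_c\wedge e_d=0$. Write $e_{ij\cdots}=e_i\wedge e_j\wedge\cdots$; bases in degrees $2,3,4$ are $\{e_{ab},e_{ac},e_{ad},e_{bc},e_{bd},e_{cd}\}$, $\{e_{abc},e_{abd},e_{acd},e_{bcd}\}$, $\{e_{abcd}\}$. $\Omega=\Lambda\otimes\mathcal{A}$ is the free right $\mathcal{A}$-module on $\Lambda$, with algebra structure given by those of $\Lambda$, $\mathcal{A}$ and the following cross relations, where $(u,v)$ is either $(a,c)$ or $(b,d)$: $ve_b=e_bv$, $ue_c=e_cu$, $ue_d=q^{-1}e_du$, $ve_d=qe_dv$, $ue_b=e_bu+q\mu e_dv$, $ve_c=e_cv+q\mu e_du$, $ve_a=q^{-1}e_av+\mu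 e_bu$, $ue_a=qe_au+\mu e_cv+q\mu^2e_du$. The exterior derivative is $\mathrm{d}\omega=-(\theta\wedge\omega-(-1)^{|\omega|}\omega\wedge\theta)$, $\theta=e_a+e_d$. The Hodge operator $\star:\Omega^i\to\Omega^{4-i}$ is the right $\mathcal{A}$-linear map with $\star1=e_{abcd}$, $\star e_{abcd}=1$, $\star e_a=-e_{abc}-\mu e_{bcd}$, $\star e_b=-e_{abd}$, $\star e_c=q^2e_{acd}$, $\star e_d=e_{bcd}$, $\star e_{ab}=-e_{ab}+2\mu e_{bd}$, $\star e_{ac}=e_{ac}$, $\star e_{ad}=\frac{1}{1+q^2}(2e_{bc}-q^2\mu e_{ad})$, $\star e_{bc}=\frac{q^2}{1+q^2}(2e_{ad}+\mu e_{bc})$, $\star e_{bd}=e_{bd}$, $\star e_{cd}=-e_{cd}$, $\star e_{abc}=-e_a-\mu e_d$, $\star e_{abd}=-e_b$, $\star e_{acd}=q^{-2}e_c$, $\star e_{bcd}=e_d$. Set $\delta=\star\circ\mathrm{d}\circ\star$.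
   Formalization: The printed curvature is not dA for the given d (the e_ad coefficient of dA is -q/4); the formula proved is F = -q/4 e_ad + (mu/12)((e_ab - e_bd) d^2 b - q (e_cd - e_ac) a^2 c), i.e. the signs of the e_ad and d^2 b terms are reversed. *)

theory Defs
  imports Complex_Main "HOL-Library.Poly_Mapping" "HOL-Library.FuncSet"
    "HOL-Algebra.QuotRing" "HOL-Algebra.Embedded_Algebras"
begin

section \<open>The free algebra on the eight generators\<close>

datatype gen = E_a | E_b | E_c | E_d | G_a | G_b | G_c | G_d

text \<open>Words get their own type so that they can be made an (additively written) monoid; the
  convolution product of \<open>HOL-Library.Poly_Mapping\<close> on finitely supported functions
  from words to the complex numbers is then the product of the free unital algebra.\<close>

datatype word = Word (letters: "gen list")

instantiation word :: monoid_add
begin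
definition zero_word :: word where "0 = Word []"
definition plus_word :: "word \<Rightarrow> word \<Rightarrow> word" where "v + w = Word (letters v @ letters w)"
instance by standard (auto simp: zero_word_def plus_word_def)
end

type_synonym free = "word \<Rightarrow>\<^sub>0 complex"

definition cst :: "complex \<Rightarrow> free" where "cst z = Poly_Mapping.single 0 z"
definition var :: "gen \<Rightarrow> free" where "var g = Poly_Mapping.single (Word [g]) 1"

abbreviation "ea \<equiv> var E_a"
abbreviation "eb \<equiv> var E_b"
abbreviation "ec \<equiv> var E_c"
abbreviation "ed \<equiv> var E_d"
abbreviation "ga \<equiv> var G_a"
abbreviation "gb \<equiv> var G_b"
abbreviation "gc \<equiv> var G_c"
abbreviation "gd \<equiv> var G_d"

definition free_ring :: "free ring" where
  "free_ring = \<lparr>carrier = UNIV, mult = (*), one = 1, zero = 0, add = (+)\<rparr>"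

section \<open>The algebra \<open>\<Omega>\<close> of differential forms on reduced \<open>\<complex>\<^sub>q[SL\<^sub>2]\<close>\<close>

definition mu :: "complex \<Rightarrow> complex" where "mu q = 1 - inverse (q ^ 2)"

text \<open>A relation \<open>l = r\<close> is recorded as the element \<open>l - r\<close>.\<close>

definition relations_A :: "complex \<Rightarrow> free set" where
  "relations_A q =
    { gb * ga - cst q * ga * gb,
      gc * ga - cst q * ga * gc,
      gd * gb - cst q * gb * gd,
      gd * gc - cst q * gc * gd,
      gc * gb - gb * gc,
      gd * ga - ga * gd - cst (q * mu q) * gb * gc,
      ga * gd - cst (inverse q) * gb * gc - 1,
      ga ^ 3 - 1, gd ^ 3 - 1, gb ^ 3, gc ^ 3 }"

definition relations_Lambda :: "complex \<Rightarrow> free set" where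
  "relations_Lambda q =
    { eb * ec + ec * eb, eb * ed + ed * eb, ec * ed + ed * ec, eb * eb, ec * ec, ed * ed,
      ea * ea - cst (mu q) * eb * ec,
      ea * ed + ed * ea + cst (mu q) * eb * ec,
      ea * eb + cst (q ^ 2) * eb * ea - cst (mu q) * eb * ed,
      ec * ea + cst (q ^ 2) * ea * ec + cst (mu q) * ec * ed }"

definition relations_cross :: "complex \<Rightarrow> free set" where
  "relations_cross q = (\<Union>(u, v) \<in> {(ga, gc), (gb, gd)}.
    { v * eb - eb * v,
      u * ec - ec * u,
      u * ed - cst (inverse q) * ed * u,
      v * ed - cst q * ed * v,
      u * eb - (eb * u + cst (q * mu q) * ed * v),
      v * ec - (ec * v + cst (q * mu q) * ed * u),
      v * ea - (cst (inverse q) * ea * v + cst (mu q) * eb * u),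
      u * ea - (cst q * ea * u + cst (mu q) * ec * v + cst (q * (mu q) ^ 2) * ed * u) })"

text \<open>The cross relations move every algebra generator to the right of every form, so the algebra
  presented here is \<open>\<Lambda> \<otimes> \<A>\<close>, free as a right module over its degree-0 part \<open>\<A>\<close>.\<close>

definition rel_ideal :: "complex \<Rightarrow> free set" where
  "rel_ideal q = genideal free_ring (relations_A q \<union> relations_Lambda q \<union> relations_cross q)"

definition Omega :: "complex \<Rightarrow> free set ring" where
  "Omega q = free_ring Quot (rel_ideal q)"

definition cls :: "complex \<Rightarrow> free \<Rightarrow> free set" where
  "cls q x = rel_ideal q +>\<^bsub>free_ring\<^esub> x"

text \<open>All relations are homogeneous for the form degree, in which the \<open>e\<close>'s have degree 1 and
  \<open>a, b, c, d\<close> have degree 0. Relations of positive degree do not affect degree 0, so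
  \<open>\<Omega>\<^sup>0\<close> is the algebra presented by \<open>relations_A\<close> alone.\<close>

definition form_degree :: "word \<Rightarrow> nat" where
  "form_degree w = length (filter (\<lambda>g. g \<in> {E_a, E_b, E_c, E_d}) (letters w))"

definition Omega_deg :: "complex \<Rightarrow> nat \<Rightarrow> free set set" where
  "Omega_deg q i = cls q ` {x. \<forall>w \<in> Poly_Mapping.keys x. form_degree w = i}"

abbreviation calA :: "complex \<Rightarrow> free set set" where "calA q \<equiv> Omega_deg q 0"

text \<open>The scalars inside \<open>\<Omega>\<close>, for use with the notions of span and independence of
  \<open>HOL-Algebra.Embedded_Algebras\<close>.\<close>

definition scalars :: "complex \<Rightarrow> free set set" where
  "scalars q = cls q ` range cst"

definition is_basis_of :: "complex \<Rightarrow> free set list \<Rightarrow> free set set \<Rightarrow> bool" where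
  "is_basis_of q vs V \<longleftrightarrow>
     ring.independent (Omega q) (scalars q) vs \<and> ring.Span (Omega q) (scalars q) vs = V"

section \<open>Exterior derivative, Hodge operator, Maxwell operator\<close>

abbreviation theta :: free where "theta \<equiv> ea + ed"

text \<open>The derivative of a form of degree \<open>i\<close>, as a function of \<open>i\<close> and the form.\<close>

definition ext_d :: "complex \<Rightarrow> nat \<Rightarrow> free set \<Rightarrow> free set" where
  "ext_d q i w = \<ominus>\<^bsub>Omega q\<^esub> ((cls q theta \<otimes>\<^bsub>Omega q\<^esub> w) \<ominus>\<^bsub>Omega q\<^esub>
                 (cls q ((-1) ^ i) \<otimes>\<^bsub>Omega q\<^esub> (w \<otimes>\<^bsub>Omega q\<^esub> cls q theta)))"

definition hodge_table :: "complex \<Rightarrow> (free \<times> free) set" where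
  "hodge_table q =
    { (1, ea * eb * ec * ed),
      (ea * eb * ec * ed, 1),
      (ea, - (ea * eb * ec) - cst (mu q) * eb * ec * ed),
      (eb, - (ea * eb * ed)),
      (ec, cst (q ^ 2) * ea * ec * ed),
      (ed, eb * ec * ed),
      (ea * eb, - (ea * eb) + cst (2 * mu q) * eb * ed),
      (ea * ec, ea * ec),
      (ea * ed, cst (1 / (1 + q ^ 2)) * (cst 2 * eb * ec - cst (q ^ 2 * mu q) * ea * ed)),
      (eb * ec, cst (q ^ 2 / (1 + q ^ 2)) * (cst 2 * ea * ed + cst (mu q) * eb * ec)),
      (eb * ed, eb * ed),
      (ec * ed, - (ec * ed)),
      (ea * eb * ec, - ea - cst (mu q) * ed),
      (ea * eb * ed, - eb),
      (ea * ec * ed, cst (inverse (q ^ 2)) * ec),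
      (eb * ec * ed, ed) }"

text \<open>The value outside the carrier is fixed (by extensionality) only to make the map unique.\<close>

definition hodge :: "complex \<Rightarrow> free set \<Rightarrow> free set" where
  "hodge q = (THE f. f \<in> carrier (Omega q) \<rightarrow>\<^sub>E carrier (Omega q) \<and>
     (\<forall>x \<in> carrier (Omega q). \<forall>y \<in> carrier (Omega q).
        f (x \<oplus>\<^bsub>Omega q\<^esub> y) = f x \<oplus>\<^bsub>Omega q\<^esub> f y) \<and>
     (\<forall>x \<in> carrier (Omega q). \<forall>u \<in> calA q.
        f (x \<otimes>\<^bsub>Omega q\<^esub> u) = f x \<otimes>\<^bsub>Omega q\<^esub> u) \<and>
     (\<forall>(x, y) \<in> hodge_table q. f (cls q x) = cls q y))"

text \<open>\<open>\<delta>\<close> on forms of degree \<open>i \<le> 4\<close>: the Hodge operator sends these to degree \<open>4 - i\<close>.\<close>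

definition codiff :: "complex \<Rightarrow> nat \<Rightarrow> free set \<Rightarrow> free set" where
  "codiff q i w = hodge q (ext_d q (4 - i) (hodge q w))"

definition Maxwell :: "complex \<Rightarrow> free set \<Rightarrow> free set" where
  "Maxwell q w = codiff q 2 (ext_d q 1 w)"

definition valid_theta_sources :: "complex \<Rightarrow> free set set" where
  "valid_theta_sources q =
     {cls q theta \<otimes>\<^bsub>Omega q\<^esub> f | f. f \<in> calA q} \<inter> Maxwell q ` Omega_deg q 1"

definition gauge_field :: "complex \<Rightarrow> free set" where
  "gauge_field q = cls q
     (- cst (q ^ 2 / 12) * theta * gb * gc * (1 + gb * gc)
      - cst (q * mu q / 12) * (ea + ec * ga ^ 2 * gc))"

text \<open>Two signs differ from the formula printed in the source,
  \<open>q/4 e\<^sub>a\<^sub>d - \<mu>/12 ((e\<^sub>a\<^sub>b - e\<^sub>b\<^sub>d) d\<^sup>2b + q (e\<^sub>c\<^sub>d - e\<^sub>a\<^sub>c) a\<^sup>2c)\<close>, which cannot be the curvature of any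
  gauge field because it is not closed: its derivative is a nonzero multiple of
  \<open>e\<^sub>a\<^sub>b\<^sub>c + e\<^sub>b\<^sub>c\<^sub>d\<close>. With \<open>d\<omega> = -(\<theta>\<omega> - (-1)\<^bsup>|\<omega>|\<^esup>\<omega>\<theta>)\<close> the
  derivative of \<open>gauge_field\<close> has the opposite sign in the \<open>e\<^sub>a\<^sub>d\<close> and \<open>d\<^sup>2b\<close> terms.\<close>

definition curvature :: "complex \<Rightarrow> free set" where
  "curvature q = cls q
     (- cst (q / 4) * ea * ed
      + cst (mu q / 12) * ((ea * eb - eb * ed) * gd ^ 2 * gb
                           - cst q * (ec * ed - ea * ec) * ga ^ 2 * gc))"

end

(* The algebra A is the span of the 27 monomials a^m b^n c^k, with d = a^2 (1 + q^2 bc), and the cross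
   relations say that left multiplication by a, b, c, d on Lambda (x) A is given by a 2x2 matrix
   (twist_uu, twist_uv; twist_vu, twist_vv) of scalar operators on Lambda. This gives an explicit
   representation of the free algebra on C^16 (x) C^27 that kills the relations; conversely the relations
   bring every word into the normal form read off from its action on 1. Hence Omega is exactly this
   432-dimensional space, and theta, d and the Hodge operator become explicit operators on coordinates.

   For the classification of the sources, 22 linear functionals vanish on the image of Max, and on the
   27-dimensional space of all theta f their common kernel is spanned by theta, theta a, ..., theta d. Fourteen
   of them already vanish on all coexact 1-forms, the other eight need the curvature to be exact. Explicit
   gauge fields realise the five sources. *)
theory Submission
  imports Defs "HOL-Library.Function_Algebras"
begin

text \<open>The left action comes from the matrix coproduct of quantum SL_2. The four twist
  operators satisfy the relations of A themselves, so \<open>gen_a\<close>, ...,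
  \<open>gen_d\<close> form the tensor product of a representation on \<Lambda> with the regular one
  on A, and the relations are checked on each factor separately. Rewriting modulo the ideal can only
  prove equalities of classes; independence of the sources and existence of the Hodge operator need
  the model. The obstacle in the exterior derivative is right multiplication by \<theta>, which the
  left action does not supply. It commutes with all left multiplications, so an explicit formula for
  it has to be tested only on 1 and against the letters of a normal word. The Hodge operator is a
  definite description and needs existence and uniqueness. Its right linearity holds because
  functions on the right change the coefficients while the table changes the form index. Apart from
  the factor 1/12, all scalars in the model lie in Z[q], where q^2 = -1 - q makes equality a
  comparison of polynomials of degree at most 1.\<close>

section \<open>The coordinate model\<close>

text \<open>A tensor \<open>w\<close> stands for the form with coefficient \<open>w I m n k\<close> at \<open>e\<^sub>I a\<^sup>m b\<^sup>n c\<^sup>k\<close>.\<close>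

datatype form = F1 | Fa | Fb | Fc | Fd | Fab | Fac | Fad | Fbc | Fbd | Fcd
  | Fabc | Fabd | Facd | Fbcd | Fabcd

datatype three = T0 | T1 | T2

type_synonym coord = "three \<Rightarrow> three \<Rightarrow> three \<Rightarrow> complex"
type_synonym tensor = "form \<Rightarrow> coord"

primrec succ3 :: "three \<Rightarrow> three" where "succ3 T0 = T1" | "succ3 T1 = T2" | "succ3 T2 = T0"
primrec pred3 :: "three \<Rightarrow> three" where "pred3 T0 = T2" | "pred3 T1 = T0" | "pred3 T2 = T1"
primrec add3 :: "three \<Rightarrow> three \<Rightarrow> three" where
  "add3 T0 m = m" | "add3 T1 m = succ3 m" | "add3 T2 m = pred3 m"

definition smul :: "complex \<Rightarrow> tensor \<Rightarrow> tensor" where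
  "smul z w = (\<lambda>I m n k. z * w I m n k)"

lemma smul_apply [simp]: "smul z w I m n k = z * w I m n k"
  by (simp add: smul_def)

lemma tensor_eqI: "(\<And>I m n k. x I m n k = y I m n k) \<Longrightarrow> x = (y :: tensor)"
  by (intro ext)

definition lin :: "(tensor \<Rightarrow> tensor) \<Rightarrow> bool" where
  "lin T \<longleftrightarrow> (\<forall>x y. T (x + y) = T x + T y) \<and> (\<forall>z x. T (smul z x) = smul z (T x))"

lemma linI: "(\<And>x y. T (x + y) = T x + T y) \<Longrightarrow> (\<And>z x. T (smul z x) = smul z (T x)) \<Longrightarrow> lin T"
  by (simp add: lin_def)

lemma smul_add: "smul z (x + y) = smul z x + smul z y"
  and smul_smul: "smul z (smul z' x) = smul (z * z') x"
  and smul_0 [simp]: "smul 0 x = 0" "smul z 0 = 0"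
  and smul_1 [simp]: "smul 1 x = x"
  and smul_minus: "smul (- 1) x = - x"
  by (intro tensor_eqI; simp add: algebra_simps)+

lemma lin_add: "lin T \<Longrightarrow> T (x + y) = T x + T y"
  and lin_smul: "lin T \<Longrightarrow> T (smul z x) = smul z (T x)"
  by (simp_all add: lin_def)

lemma lin_zero: "lin T \<Longrightarrow> T 0 = 0"
  using lin_smul[of T 0 0] by simp

lemma lin_uminus: "lin T \<Longrightarrow> T (- x) = - T x"
  using lin_smul[of T "- 1" x] by (simp add: smul_minus)

lemma lin_diff: "lin T \<Longrightarrow> T (x - y) = T x - T y"
  by (simp only: diff_conv_add_uminus lin_add lin_uminus)

lemma lin_sum: "finite S \<Longrightarrow> lin T \<Longrightarrow> T (\<Sum>i\<in>S. f i) = (\<Sum>i\<in>S. T (f i))"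
proof (induction S rule: finite_induct)
  case (insert x F)
  then show ?case
    using lin_add[of T "f x" "\<Sum>i\<in>F. f i"] by (simp only: sum.insert [OF insert.hyps(1,2)])
next
  case empty
  then show ?case
    using lin_zero[of T] by (simp only: sum.empty)
qed

locale cube_root =
  fixes q :: complex
  assumes cube: "q ^ 3 = 1" and neq1: "q \<noteq> 1"
begin

section \<open>Arithmetic in Z[q]\<close>

lemma qq: "q * q = - 1 - q"
proof -
  have "(q - 1) * (q * q + q + 1) = 0"
    using cube by (simp add: algebra_simps power3_eq_cube)
  with neq1 have "q * q + q + 1 = 0"
    by (simp only: mult_eq_0_iff right_minus_eq) simp
  then have "q * q - (- 1 - q) = 0"
    by (simp add: algebra_simps)
  then show ?thesis
    by (simp only: right_minus_eq)
qed

text \<open>The form of \<open>qq\<close> for right-nested products; together they let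
  \<open>qring\<close> reduce every polynomial in q to the shape x + y q.\<close>

lemma qqz: "q * (q * z) = - z - q * z"
  by (simp only: qq mult.assoc [symmetric]) (simp add: algebra_simps)

lemmas qring = algebra_simps qq qqz

section \<open>Multiplication operators on functions and on \<Lambda>\<close>

primrec wt :: "three \<Rightarrow> complex" where "wt T0 = 1" | "wt T1 = q" | "wt T2 = - 1 - q"

text \<open>Since a^3 = 1, the exponent of a wraps around. For b and c the value 0 at exponent
  \<open>T0\<close> replaces the wrap-around, because b^3 = c^3 = 0; their weight
  \<open>wt m\<close> = q^m comes from moving b or c past a^m.\<close>

definition left_a :: "tensor \<Rightarrow> tensor" where
  "left_a w = (\<lambda>I m n k. w I (pred3 m) n k)"
definition left_b :: "tensor \<Rightarrow> tensor" where
  "left_b w = (\<lambda>I m n k. if n = T0 then 0 else wt m * w I m (pred3 n) k)"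
definition left_c :: "tensor \<Rightarrow> tensor" where
  "left_c w = (\<lambda>I m n k. if k = T0 then 0 else wt m * w I m n (pred3 k))"
definition left_d :: "tensor \<Rightarrow> tensor" where
  "left_d w = left_a (left_a w) + smul (- 1 - q) (left_a (left_a (left_b (left_c w))))"

text \<open>For a function \<open>f\<close>, the product \<open>f \<theta>\<close> is the sum of \<open>e\<^sub>j\<close> times \<open>rt_j f\<close>. The formulas come from
  moving \<open>a\<^sup>m b\<^sup>n c\<^sup>k\<close> past \<open>e\<^sub>a + e\<^sub>d\<close> with the cross relations; \<open>br n\<close> is the balanced \<open>q\<close>-integer
  \<open>[n] = (q\<^sup>n - q\<^sup>-\<^sup>n)/(q - q\<^sup>-\<^sup>1)\<close> and \<open>wt' n = q\<^sup>-\<^sup>n\<close>.\<close>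

primrec br :: "three \<Rightarrow> complex" where "br T0 = 0" | "br T1 = 1" | "br T2 = - 1"
primrec wt' :: "three \<Rightarrow> complex" where "wt' T0 = 1" | "wt' T1 = - 1 - q" | "wt' T2 = q"

definition rt_a :: "tensor \<Rightarrow> tensor" where
  "rt_a w = (\<lambda>I m n k. wt m * wt n * wt' k * w I m n k)"
definition rt_b :: "tensor \<Rightarrow> tensor" where
  "rt_b w = (\<lambda>I m n k. (1 - q) * wt n * br (succ3 k) * w I (pred3 m) n (succ3 k))"
definition rt_c :: "tensor \<Rightarrow> tensor" where
  "rt_c w = (\<lambda>I m n k. (1 - q) * br (succ3 n) * wt' k * w I (succ3 m) (succ3 n) k +
    (if k = T0 then 0 else (- 2 - q) * wt' (pred3 k) *
       (br n + br (succ3 m) * wt (succ3 m) * wt n) * w I (succ3 m) n (pred3 k)))"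
text \<open>The diagonal coefficient at e_d. Both a and b take the place of u in the cross
  relations, so the exponents m and n enter only through their sum. For instance, a \<theta>
  contributes q mu^2 + q^-1 = 2 + 2q.\<close>

fun rt_coeff :: "three \<Rightarrow> three \<Rightarrow> complex" where
  "rt_coeff T0 k = wt k"
| "rt_coeff T1 T0 = 2 + 2 * q" | "rt_coeff T1 T1 = - 2 - 3 * q" | "rt_coeff T1 T2 = q"
| "rt_coeff T2 T0 = - 3 - 2 * q" | "rt_coeff T2 T1 = 2 + 2 * q" | "rt_coeff T2 T2 = 1"
definition rt_d :: "tensor \<Rightarrow> tensor" where
  "rt_d w = (\<lambda>I m n k. rt_coeff (add3 m n) k * w I m n k +
    (3 + 3 * q) * wt' m * br (succ3 n) * br (succ3 k) * w I m (succ3 n) (succ3 k))"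

text \<open>The tables list the coordinates of the image, so they are the transposes of the multiplication
  tables on the basis \<open>e\<^sub>I\<close>; all scalars are reduced with \<open>q\<^sup>2 = - 1 - q\<close>.\<close>

primrec wedge_a :: "tensor \<Rightarrow> tensor" where
  "wedge_a w F1 = (\<lambda>m n k. 0)"
| "wedge_a w Fa = (\<lambda>m n k. w F1 m n k)"
| "wedge_a w Fb = (\<lambda>m n k. 0)"
| "wedge_a w Fc = (\<lambda>m n k. 0)"
| "wedge_a w Fd = (\<lambda>m n k. 0)"
| "wedge_a w Fab = (\<lambda>m n k. w Fb m n k)"
| "wedge_a w Fac = (\<lambda>m n k. w Fc m n k)"
| "wedge_a w Fad = (\<lambda>m n k. w Fd m n k)"
| "wedge_a w Fbc = (\<lambda>m n k. (1 - q) * w Fa m n k)"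
| "wedge_a w Fbd = (\<lambda>m n k. 0)"
| "wedge_a w Fcd = (\<lambda>m n k. 0)"
| "wedge_a w Fabc = (\<lambda>m n k. w Fbc m n k)"
| "wedge_a w Fabd = (\<lambda>m n k. w Fbd m n k)"
| "wedge_a w Facd = (\<lambda>m n k. w Fcd m n k)"
| "wedge_a w Fbcd = (\<lambda>m n k. (1 - q) * w Fad m n k)"
| "wedge_a w Fabcd = (\<lambda>m n k. w Fbcd m n k)"

primrec wedge_b :: "tensor \<Rightarrow> tensor" where
  "wedge_b w F1 = (\<lambda>m n k. 0)"
| "wedge_b w Fa = (\<lambda>m n k. 0)"
| "wedge_b w Fb = (\<lambda>m n k. w F1 m n k)"
| "wedge_b w Fc = (\<lambda>m n k. 0)"
| "wedge_b w Fd = (\<lambda>m n k. 0)"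
| "wedge_b w Fab = (\<lambda>m n k. - q * w Fa m n k)"
| "wedge_b w Fac = (\<lambda>m n k. 0)"
| "wedge_b w Fad = (\<lambda>m n k. 0)"
| "wedge_b w Fbc = (\<lambda>m n k. w Fc m n k)"
| "wedge_b w Fbd = (\<lambda>m n k. (1 + 2*q) * w Fa m n k + w Fd m n k)"
| "wedge_b w Fcd = (\<lambda>m n k. 0)"
| "wedge_b w Fabc = (\<lambda>m n k. - q * w Fac m n k)"
| "wedge_b w Fabd = (\<lambda>m n k. - q * w Fad m n k)"
| "wedge_b w Facd = (\<lambda>m n k. 0)"
| "wedge_b w Fbcd = (\<lambda>m n k. (-1 - 2*q) * w Fac m n k + w Fcd m n k)"
| "wedge_b w Fabcd = (\<lambda>m n k. - q * w Facd m n k)"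

primrec wedge_c :: "tensor \<Rightarrow> tensor" where
  "wedge_c w F1 = (\<lambda>m n k. 0)"
| "wedge_c w Fa = (\<lambda>m n k. 0)"
| "wedge_c w Fb = (\<lambda>m n k. 0)"
| "wedge_c w Fc = (\<lambda>m n k. w F1 m n k)"
| "wedge_c w Fd = (\<lambda>m n k. 0)"
| "wedge_c w Fab = (\<lambda>m n k. 0)"
| "wedge_c w Fac = (\<lambda>m n k. (1 + q) * w Fa m n k)"
| "wedge_c w Fad = (\<lambda>m n k. 0)"
| "wedge_c w Fbc = (\<lambda>m n k. - w Fb m n k)"
| "wedge_c w Fbd = (\<lambda>m n k. 0)"
| "wedge_c w Fcd = (\<lambda>m n k. (-1 + q) * w Fa m n k + w Fd m n k)"
| "wedge_c w Fabc = (\<lambda>m n k. (-1 - q) * w Fab m n k)"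
| "wedge_c w Fabd = (\<lambda>m n k. 0)"
| "wedge_c w Facd = (\<lambda>m n k. (1 + q) * w Fad m n k)"
| "wedge_c w Fbcd = (\<lambda>m n k. (-1 + q) * w Fab m n k - w Fbd m n k)"
| "wedge_c w Fabcd = (\<lambda>m n k. (-1 - q) * w Fabd m n k)"

primrec wedge_d :: "tensor \<Rightarrow> tensor" where
  "wedge_d w F1 = (\<lambda>m n k. 0)"
| "wedge_d w Fa = (\<lambda>m n k. 0)"
| "wedge_d w Fb = (\<lambda>m n k. 0)"
| "wedge_d w Fc = (\<lambda>m n k. 0)"
| "wedge_d w Fd = (\<lambda>m n k. w F1 m n k)"
| "wedge_d w Fab = (\<lambda>m n k. 0)"
| "wedge_d w Fac = (\<lambda>m n k. 0)"
| "wedge_d w Fad = (\<lambda>m n k. - w Fa m n k)"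
| "wedge_d w Fbc = (\<lambda>m n k. (-1 + q) * w Fa m n k)"
| "wedge_d w Fbd = (\<lambda>m n k. - w Fb m n k)"
| "wedge_d w Fcd = (\<lambda>m n k. - w Fc m n k)"
| "wedge_d w Fabc = (\<lambda>m n k. 0)"
| "wedge_d w Fabd = (\<lambda>m n k. w Fab m n k)"
| "wedge_d w Facd = (\<lambda>m n k. w Fac m n k)"
| "wedge_d w Fbcd = (\<lambda>m n k. (-1 + q) * w Fad m n k + w Fbc m n k)"
| "wedge_d w Fabcd = (\<lambda>m n k. - w Fabc m n k)"

text \<open>For \<open>(u, v) = (a, c)\<close> and \<open>(u, v) = (b, d)\<close> alike, \<open>u w = twist_uu(w) u + twist_uv(w) v\<close> and
  \<open>v w = twist_vu(w) u + twist_vv(w) v\<close> for \<open>w\<close> in \<open>\<Lambda>\<close>.\<close>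

primrec twist_uu :: "tensor \<Rightarrow> tensor" where
  "twist_uu w F1 = (\<lambda>m n k. w F1 m n k)"
| "twist_uu w Fa = (\<lambda>m n k. q * w Fa m n k)"
| "twist_uu w Fb = (\<lambda>m n k. w Fb m n k)"
| "twist_uu w Fc = (\<lambda>m n k. w Fc m n k)"
| "twist_uu w Fd = (\<lambda>m n k. (3 + 3*q) * w Fa m n k + (-1 - q) * w Fd m n k)"
| "twist_uu w Fab = (\<lambda>m n k. q * w Fab m n k)"
| "twist_uu w Fac = (\<lambda>m n k. q * w Fac m n k)"
| "twist_uu w Fad = (\<lambda>m n k. w Fad m n k)"
| "twist_uu w Fbc = (\<lambda>m n k. w Fbc m n k)"
| "twist_uu w Fbd = (\<lambda>m n k. (-3 - 3*q) * w Fab m n k + (-1 - q) * w Fbd m n k)"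
| "twist_uu w Fcd = (\<lambda>m n k. (-1 - q) * w Fcd m n k)"
| "twist_uu w Fabc = (\<lambda>m n k. q * w Fabc m n k)"
| "twist_uu w Fabd = (\<lambda>m n k. w Fabd m n k)"
| "twist_uu w Facd = (\<lambda>m n k. w Facd m n k)"
| "twist_uu w Fbcd = (\<lambda>m n k. (-1 - q) * w Fbcd m n k)"
| "twist_uu w Fabcd = (\<lambda>m n k. w Fabcd m n k)"

primrec twist_uv :: "tensor \<Rightarrow> tensor" where
  "twist_uv w F1 = (\<lambda>m n k. 0)"
| "twist_uv w Fa = (\<lambda>m n k. 0)"
| "twist_uv w Fb = (\<lambda>m n k. 0)"
| "twist_uv w Fc = (\<lambda>m n k. (1 - q) * w Fa m n k)"
| "twist_uv w Fd = (\<lambda>m n k. (1 + 2*q) * w Fb m n k)"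
| "twist_uv w Fab = (\<lambda>m n k. 0)"
| "twist_uv w Fac = (\<lambda>m n k. 0)"
| "twist_uv w Fad = (\<lambda>m n k. (-2 - q) * w Fab m n k)"
| "twist_uv w Fbc = (\<lambda>m n k. (-1 + q) * w Fab m n k)"
| "twist_uv w Fbd = (\<lambda>m n k. 0)"
| "twist_uv w Fcd = (\<lambda>m n k. (1 + 2*q) * w Fad m n k + (-1 - 2*q) * w Fbc m n k)"
| "twist_uv w Fabc = (\<lambda>m n k. 0)"
| "twist_uv w Fabd = (\<lambda>m n k. 0)"
| "twist_uv w Facd = (\<lambda>m n k. (2 + q) * w Fabc m n k)"
| "twist_uv w Fbcd = (\<lambda>m n k. (-1 - 2*q) * w Fabd m n k)"
| "twist_uv w Fabcd = (\<lambda>m n k. 0)"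

primrec twist_vu :: "tensor \<Rightarrow> tensor" where
  "twist_vu w F1 = (\<lambda>m n k. 0)"
| "twist_vu w Fa = (\<lambda>m n k. 0)"
| "twist_vu w Fb = (\<lambda>m n k. (1 - q) * w Fa m n k)"
| "twist_vu w Fc = (\<lambda>m n k. 0)"
| "twist_vu w Fd = (\<lambda>m n k. (1 + 2*q) * w Fc m n k)"
| "twist_vu w Fab = (\<lambda>m n k. 0)"
| "twist_vu w Fac = (\<lambda>m n k. 0)"
| "twist_vu w Fad = (\<lambda>m n k. (1 - q) * w Fac m n k)"
| "twist_vu w Fbc = (\<lambda>m n k. (1 - q) * w Fac m n k)"
| "twist_vu w Fbd = (\<lambda>m n k. (-2 - q) * w Fad m n k + (1 + 2*q) * w Fbc m n k)"
| "twist_vu w Fcd = (\<lambda>m n k. 0)"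
| "twist_vu w Fabc = (\<lambda>m n k. 0)"
| "twist_vu w Fabd = (\<lambda>m n k. (1 - q) * w Fabc m n k)"
| "twist_vu w Facd = (\<lambda>m n k. 0)"
| "twist_vu w Fbcd = (\<lambda>m n k. (-2 - q) * w Facd m n k)"
| "twist_vu w Fabcd = (\<lambda>m n k. 0)"

primrec twist_vv :: "tensor \<Rightarrow> tensor" where
  "twist_vv w F1 = (\<lambda>m n k. w F1 m n k)"
| "twist_vv w Fa = (\<lambda>m n k. (-1 - q) * w Fa m n k)"
| "twist_vv w Fb = (\<lambda>m n k. w Fb m n k)"
| "twist_vv w Fc = (\<lambda>m n k. w Fc m n k)"
| "twist_vv w Fd = (\<lambda>m n k. q * w Fd m n k)"
| "twist_vv w Fab = (\<lambda>m n k. (-1 - q) * w Fab m n k)"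
| "twist_vv w Fac = (\<lambda>m n k. (-1 - q) * w Fac m n k)"
| "twist_vv w Fad = (\<lambda>m n k. w Fad m n k)"
| "twist_vv w Fbc = (\<lambda>m n k. w Fbc m n k)"
| "twist_vv w Fbd = (\<lambda>m n k. (3 + 3*q) * w Fab m n k + q * w Fbd m n k)"
| "twist_vv w Fcd = (\<lambda>m n k. q * w Fcd m n k)"
| "twist_vv w Fabc = (\<lambda>m n k. (-1 - q) * w Fabc m n k)"
| "twist_vv w Fabd = (\<lambda>m n k. w Fabd m n k)"
| "twist_vv w Facd = (\<lambda>m n k. w Facd m n k)"
| "twist_vv w Fbcd = (\<lambda>m n k. (-3 - 3*q) * w Fabc m n k + q * w Fbcd m n k)"
| "twist_vv w Fabcd = (\<lambda>m n k. w Fabcd m n k)"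

text \<open>The Hodge table transposed, with 1/(1 + q^2) = 1 + q and q^2/(1 + q^2) = -q.\<close>

primrec star :: "tensor \<Rightarrow> tensor" where
  "star w F1 = (\<lambda>m n k. w Fabcd m n k)"
| "star w Fa = (\<lambda>m n k. - w Fabc m n k)"
| "star w Fb = (\<lambda>m n k. - w Fabd m n k)"
| "star w Fc = (\<lambda>m n k. q * w Facd m n k)"
| "star w Fd = (\<lambda>m n k. (-1 + q) * w Fabc m n k + w Fbcd m n k)"
| "star w Fab = (\<lambda>m n k. - w Fab m n k)"
| "star w Fac = (\<lambda>m n k. w Fac m n k)"
| "star w Fad = (\<lambda>m n k. (1 + 2*q) * w Fad m n k - 2*q * w Fbc m n k)"
| "star w Fbc = (\<lambda>m n k. (2 + 2*q) * w Fad m n k + (-1 - 2*q) * w Fbc m n k)"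
| "star w Fbd = (\<lambda>m n k. (2 - 2*q) * w Fab m n k + w Fbd m n k)"
| "star w Fcd = (\<lambda>m n k. - w Fcd m n k)"
| "star w Fabc = (\<lambda>m n k. - w Fa m n k)"
| "star w Fabd = (\<lambda>m n k. - w Fb m n k)"
| "star w Facd = (\<lambda>m n k. (-1 - q) * w Fc m n k)"
| "star w Fbcd = (\<lambda>m n k. (-1 + q) * w Fa m n k + w Fd m n k)"
| "star w Fabcd = (\<lambda>m n k. w F1 m n k)"

text \<open>A form with coefficients f_I at e_I is sent to the sum of the products e_I e_j times
  \<open>rt_j\<close> of f_I. The scalars come from straightening e_I e_j; for instance e_b e_a = -q
  e_ab + (1 + 2q) e_bd.\<close>

primrec rtheta :: "tensor \<Rightarrow> tensor" where
  "rtheta w F1 = (\<lambda>m n k. 0)"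
| "rtheta w Fa = (\<lambda>m n k. rt_a w F1 m n k)"
| "rtheta w Fb = (\<lambda>m n k. rt_b w F1 m n k)"
| "rtheta w Fc = (\<lambda>m n k. rt_c w F1 m n k)"
| "rtheta w Fd = (\<lambda>m n k. rt_d w F1 m n k)"
| "rtheta w Fab = (\<lambda>m n k. rt_b w Fa m n k - q * rt_a w Fb m n k)"
| "rtheta w Fac = (\<lambda>m n k. rt_c w Fa m n k + (1 + q) * rt_a w Fc m n k)"
| "rtheta w Fad = (\<lambda>m n k. rt_d w Fa m n k - rt_a w Fd m n k)"
| "rtheta w Fbc = (\<lambda>m n k. (1 - q) * rt_a w Fa m n k + rt_c w Fb m n k - rt_b w Fc m n k + (-1 + q) * rt_a w Fd m n k)"
| "rtheta w Fbd = (\<lambda>m n k. (1 + 2*q) * rt_a w Fb m n k + rt_d w Fb m n k - rt_b w Fd m n k)"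
| "rtheta w Fcd = (\<lambda>m n k. (-1 + q) * rt_a w Fc m n k + rt_d w Fc m n k - rt_c w Fd m n k)"
| "rtheta w Fabc = (\<lambda>m n k. rt_c w Fab m n k - rt_b w Fac m n k + (-1 + q) * rt_a w Fad m n k + rt_a w Fbc m n k)"
| "rtheta w Fabd = (\<lambda>m n k. (1 + 2*q) * rt_a w Fab m n k + rt_d w Fab m n k - rt_b w Fad m n k + q * rt_a w Fbd m n k)"
| "rtheta w Facd = (\<lambda>m n k. (-1 + q) * rt_a w Fac m n k + rt_d w Fac m n k - rt_c w Fad m n k + (-1 - q) * rt_a w Fcd m n k)"
| "rtheta w Fbcd = (\<lambda>m n k. (-1 + q) * rt_a w Fad m n k + rt_d w Fbc m n k - rt_c w Fbd m n k + rt_b w Fcd m n k)"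
| "rtheta w Fabcd = (\<lambda>m n k. rt_d w Fabc m n k - rt_c w Fabd m n k + rt_b w Facd m n k - rt_a w Fbcd m n k)"

text \<open>The coproduct a -> a \<otimes> a + b \<otimes> c, b -> a \<otimes> b + b \<otimes> d, c
  -> c \<otimes> a + d \<otimes> c, d -> c \<otimes> b + d \<otimes> d, with the twists as first
  factors and left multiplications as second.\<close>

definition gen_a :: "tensor \<Rightarrow> tensor" where
  "gen_a w = left_a (twist_uu w) + left_c (twist_uv w)"
definition gen_b :: "tensor \<Rightarrow> tensor" where
  "gen_b w = left_b (twist_uu w) + left_d (twist_uv w)"
definition gen_c :: "tensor \<Rightarrow> tensor" where
  "gen_c w = left_a (twist_vu w) + left_c (twist_vv w)"
definition gen_d :: "tensor \<Rightarrow> tensor" where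
  "gen_d w = left_b (twist_vu w) + left_d (twist_vv w)"

lemma lin_tables:
  "lin wedge_a"
  "lin wedge_b"
  "lin wedge_c"
  "lin wedge_d"
  "lin twist_uu"
  "lin twist_uv"
  "lin twist_vu"
  "lin twist_vv"
  "lin star"
  by (rule linI; rule tensor_eqI, rename_tac I m n k, case_tac I; simp add: algebra_simps)+

lemma lin_left: "lin left_a" "lin left_b" "lin left_c"
  by (rule linI; rule tensor_eqI; simp add: left_a_def left_b_def left_c_def algebra_simps)+

lemma lin_rt: "lin rt_a" "lin rt_b" "lin rt_c" "lin rt_d"
  by (rule linI; rule tensor_eqI; simp add: rt_a_def rt_b_def rt_c_def rt_d_def algebra_simps)+

lemma lin_left_d: "lin left_d"
  by (rule linI) (simp_all add: left_d_def lin_left[THEN lin_add] lin_left[THEN lin_smul] smul_add smul_smul mult.commute)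

lemma lin_rtheta: "lin rtheta"
  by (rule linI; rule tensor_eqI, rename_tac I m n k, case_tac I;
    simp add: lin_rt[THEN lin_add] lin_rt[THEN lin_smul] algebra_simps)

lemmas lin_basic = lin_tables lin_left lin_left_d lin_rtheta
lemmas lin_simps = lin_basic[THEN lin_add] lin_basic[THEN lin_smul] lin_basic[THEN lin_uminus]
  lin_basic[THEN lin_diff] lin_basic[THEN lin_zero]

lemma lin_gen: "lin gen_a" "lin gen_b" "lin gen_c" "lin gen_d"
  by (rule linI; simp add: gen_a_def gen_b_def gen_c_def gen_d_def lin_simps smul_add)+

section \<open>The defining relations hold in the model\<close>

lemma wedge_rels:
  "wedge_a (wedge_a w) = smul (1 - q) (wedge_b (wedge_c w))"
  "wedge_d (wedge_a w) = - wedge_a (wedge_d w) - smul (1 - q) (wedge_b (wedge_c w))"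
  "wedge_b (wedge_a w) = smul (- q) (wedge_a (wedge_b w)) + smul (1 + 2 * q) (wedge_b (wedge_d w))"
  "wedge_c (wedge_a w) = smul (1 + q) (wedge_a (wedge_c w)) - smul (1 - q) (wedge_c (wedge_d w))"
  by (rule tensor_eqI, rename_tac I m n k, case_tac I, simp_all add: qring)+
lemma wedge_rels':
  "wedge_c (wedge_b w) = - wedge_b (wedge_c w)"
  "wedge_d (wedge_b w) = - wedge_b (wedge_d w)"
  "wedge_d (wedge_c w) = - wedge_c (wedge_d w)"
  "wedge_b (wedge_b w) = 0" "wedge_c (wedge_c w) = 0" "wedge_d (wedge_d w) = 0"
  by (rule tensor_eqI, rename_tac I m n k, case_tac I, simp_all add: qring)+

text \<open>The cross relations with the function stripped off, read as recursions for the twists.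
  The constants are 1 - q = mu, 1 + 2q = q mu, 3 + 3q = q mu^2 and -1 - q = q^-1.\<close>

lemma twist_wedge_u:
  "twist_uu (wedge_a w) = smul q (wedge_a (twist_uu w)) + smul (1 - q) (wedge_c (twist_vu w))
     + smul (3 + 3 * q) (wedge_d (twist_uu w))"
  "twist_uv (wedge_a w) = smul q (wedge_a (twist_uv w)) + smul (1 - q) (wedge_c (twist_vv w))
     + smul (3 + 3 * q) (wedge_d (twist_uv w))"
  "twist_uu (wedge_b w) = wedge_b (twist_uu w) + smul (1 + 2 * q) (wedge_d (twist_vu w))"
  "twist_uv (wedge_b w) = wedge_b (twist_uv w) + smul (1 + 2 * q) (wedge_d (twist_vv w))"
  "twist_uu (wedge_c w) = wedge_c (twist_uu w)"
  "twist_uv (wedge_c w) = wedge_c (twist_uv w)"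
  "twist_uu (wedge_d w) = smul (- 1 - q) (wedge_d (twist_uu w))"
  "twist_uv (wedge_d w) = smul (- 1 - q) (wedge_d (twist_uv w))"
  by (rule tensor_eqI, rename_tac I m n k, case_tac I, simp_all add: qring)+

lemma twist_wedge_v:
  "twist_vu (wedge_a w) = smul (- 1 - q) (wedge_a (twist_vu w)) + smul (1 - q) (wedge_b (twist_uu w))"
  "twist_vv (wedge_a w) = smul (- 1 - q) (wedge_a (twist_vv w)) + smul (1 - q) (wedge_b (twist_uv w))"
  "twist_vu (wedge_b w) = wedge_b (twist_vu w)"
  "twist_vv (wedge_b w) = wedge_b (twist_vv w)"
  "twist_vu (wedge_c w) = wedge_c (twist_vu w) + smul (1 + 2 * q) (wedge_d (twist_uu w))"
  "twist_vv (wedge_c w) = wedge_c (twist_vv w) + smul (1 + 2 * q) (wedge_d (twist_uv w))"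
  "twist_vu (wedge_d w) = smul q (wedge_d (twist_vu w))"
  "twist_vv (wedge_d w) = smul q (wedge_d (twist_vv w))"
  by (rule tensor_eqI, rename_tac I m n k, case_tac I, simp_all add: qring)+

text \<open>The relations of A with \<open>twist_uu\<close>, \<open>twist_uv\<close>,
  \<open>twist_vu\<close>, \<open>twist_vv\<close> in the places of a, b, c, d: the twist matrix
  represents A on \<Lambda>.\<close>

lemma twist_rels:
  "twist_uv (twist_uu w) = smul q (twist_uu (twist_uv w))"
  "twist_vv (twist_vu w) = smul q (twist_vu (twist_vv w))"
  "twist_vu (twist_uu w) = smul q (twist_uu (twist_vu w))"
  "twist_vv (twist_uv w) = smul q (twist_uv (twist_vv w))"
  "twist_vu (twist_uv w) = twist_uv (twist_vu w)"
  "twist_uu (twist_vv w) = w + smul (- 1 - q) (twist_uv (twist_vu w))"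
  "twist_vv (twist_uu w) = w + smul q (twist_uv (twist_vu w))"
  "twist_uu (twist_uu (twist_uu w)) = w"
  "twist_vv (twist_vv (twist_vv w)) = w"
  "twist_uv (twist_uv (twist_uv w)) = 0"
  "twist_vu (twist_vu (twist_vu w)) = 0"
  by (rule tensor_eqI, rename_tac I m n k, case_tac I, simp_all add: qring)+

lemma left_rels:
  "left_b (left_a w) = smul q (left_a (left_b w))"
  "left_c (left_a w) = smul q (left_a (left_c w))"
  "left_c (left_b w) = left_b (left_c w)"
  "left_a (left_a (left_a w)) = w"
  "left_b (left_b (left_b w)) = 0"
  "left_c (left_c (left_c w)) = 0"
  unfolding left_a_def left_b_def left_c_def
  by (rule tensor_eqI, rename_tac I m n k, case_tac m; case_tac n; case_tac k; simp add: qring)+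

text \<open>Wedges and twists mix the form index with constant scalars, left multiplications change
  only the exponents.\<close>

lemma left_comm:
  "wedge_a (left_a w) = left_a (wedge_a w)"
  "wedge_a (left_b w) = left_b (wedge_a w)"
  "wedge_a (left_c w) = left_c (wedge_a w)"
  "wedge_b (left_a w) = left_a (wedge_b w)"
  "wedge_b (left_b w) = left_b (wedge_b w)"
  "wedge_b (left_c w) = left_c (wedge_b w)"
  "wedge_c (left_a w) = left_a (wedge_c w)"
  "wedge_c (left_b w) = left_b (wedge_c w)"
  "wedge_c (left_c w) = left_c (wedge_c w)"
  "wedge_d (left_a w) = left_a (wedge_d w)"
  "wedge_d (left_b w) = left_b (wedge_d w)"
  "wedge_d (left_c w) = left_c (wedge_d w)"
  "twist_uu (left_a w) = left_a (twist_uu w)"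
  "twist_uu (left_b w) = left_b (twist_uu w)"
  "twist_uu (left_c w) = left_c (twist_uu w)"
  "twist_uv (left_a w) = left_a (twist_uv w)"
  "twist_uv (left_b w) = left_b (twist_uv w)"
  "twist_uv (left_c w) = left_c (twist_uv w)"
  "twist_vu (left_a w) = left_a (twist_vu w)"
  "twist_vu (left_b w) = left_b (twist_vu w)"
  "twist_vu (left_c w) = left_c (twist_vu w)"
  "twist_vv (left_a w) = left_a (twist_vv w)"
  "twist_vv (left_b w) = left_b (twist_vv w)"
  "twist_vv (left_c w) = left_c (twist_vv w)"
  by (rule tensor_eqI, rename_tac I m n k, case_tac I;
    simp add: left_a_def left_b_def left_c_def algebra_simps)+

lemma left_d_comm:
  "wedge_a (left_d w) = left_d (wedge_a w)"
  "wedge_b (left_d w) = left_d (wedge_b w)"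
  "wedge_c (left_d w) = left_d (wedge_c w)"
  "wedge_d (left_d w) = left_d (wedge_d w)"
  "twist_uu (left_d w) = left_d (twist_uu w)"
  "twist_uv (left_d w) = left_d (twist_uv w)"
  "twist_vu (left_d w) = left_d (twist_vu w)"
  "twist_vv (left_d w) = left_d (twist_vv w)"
  by (simp_all add: left_d_def left_comm lin_simps)

lemma left_d_rels:
  "left_d (left_a w) = w + smul q (left_b (left_c w))"
  "left_a (left_d w) = w + smul (- 1 - q) (left_b (left_c w))"
  "left_d (left_b w) = smul q (left_b (left_d w))"
  "left_d (left_c w) = smul q (left_c (left_d w))"
  "left_d (left_d (left_d w)) = w"
  by (simp_all add: left_d_def left_rels lin_simps smul_add smul_smul,
      (rule tensor_eqI, simp add: qring)+)

lemmas gen_defs = gen_a_def gen_b_def gen_c_def gen_d_def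

text \<open>Expanding the coproduct leaves words in twists and left multiplications. The two kinds
  commute, so the relations of the two factors give those of the tensor product.\<close>

lemma gen_rels:
  "gen_b (gen_a w) = smul q (gen_a (gen_b w))"
  "gen_c (gen_a w) = smul q (gen_a (gen_c w))"
  "gen_d (gen_b w) = smul q (gen_b (gen_d w))"
  "gen_d (gen_c w) = smul q (gen_c (gen_d w))"
  "gen_c (gen_b w) = gen_b (gen_c w)"
  "gen_d (gen_a w) = gen_a (gen_d w) + smul (1 + 2 * q) (gen_b (gen_c w))"
  "gen_a (gen_d w) = w + smul (- 1 - q) (gen_b (gen_c w))"
  "gen_a (gen_a (gen_a w)) = w"
  "gen_d (gen_d (gen_d w)) = w"
  "gen_b (gen_b (gen_b w)) = 0"
  "gen_c (gen_c (gen_c w)) = 0"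
  unfolding gen_defs
  by (simp_all add: left_comm left_d_comm lin_simps left_rels left_d_rels twist_rels smul_add smul_smul,
      (rule tensor_eqI, simp add: qring)+)

lemma gen_wedge_u:
  "gen_a (wedge_a w) = smul q (wedge_a (gen_a w)) + smul (1 - q) (wedge_c (gen_c w))
     + smul (3 + 3 * q) (wedge_d (gen_a w))"
  "gen_b (wedge_a w) = smul q (wedge_a (gen_b w)) + smul (1 - q) (wedge_c (gen_d w))
     + smul (3 + 3 * q) (wedge_d (gen_b w))"
  "gen_a (wedge_b w) = wedge_b (gen_a w) + smul (1 + 2 * q) (wedge_d (gen_c w))"
  "gen_b (wedge_b w) = wedge_b (gen_b w) + smul (1 + 2 * q) (wedge_d (gen_d w))"
  "gen_a (wedge_c w) = wedge_c (gen_a w)"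
  "gen_b (wedge_c w) = wedge_c (gen_b w)"
  "gen_a (wedge_d w) = smul (- 1 - q) (wedge_d (gen_a w))"
  "gen_b (wedge_d w) = smul (- 1 - q) (wedge_d (gen_b w))"
  by (simp_all add: gen_defs left_comm left_d_comm lin_simps twist_wedge_u twist_wedge_v smul_add smul_smul)

lemma gen_wedge_v:
  "gen_c (wedge_a w) = smul (- 1 - q) (wedge_a (gen_c w)) + smul (1 - q) (wedge_b (gen_a w))"
  "gen_d (wedge_a w) = smul (- 1 - q) (wedge_a (gen_d w)) + smul (1 - q) (wedge_b (gen_b w))"
  "gen_c (wedge_b w) = wedge_b (gen_c w)"
  "gen_d (wedge_b w) = wedge_b (gen_d w)"
  "gen_c (wedge_c w) = wedge_c (gen_c w) + smul (1 + 2 * q) (wedge_d (gen_a w))"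
  "gen_d (wedge_c w) = wedge_c (gen_d w) + smul (1 + 2 * q) (wedge_d (gen_b w))"
  "gen_c (wedge_d w) = smul q (wedge_d (gen_c w))"
  "gen_d (wedge_d w) = smul q (wedge_d (gen_d w))"
  by (simp_all add: gen_defs left_comm left_d_comm lin_simps twist_wedge_u twist_wedge_v smul_add smul_smul)

end

section \<open>Action of the free algebra\<close>

lemma lookup_single_if: "Poly_Mapping.lookup (Poly_Mapping.single v z) u = (if u = v then z else 0)"
  by (simp add: lookup_single when_def)

lemma free_induct [case_names single add]:
  fixes x :: free
  assumes "\<And>v z. P (Poly_Mapping.single v z)" and "\<And>x y. P x \<Longrightarrow> P y \<Longrightarrow> P (x + y)"
  shows "P x"
proof (induction x rule: update_induct)
  case const
  then show ?case
    using assms(1)[of 0 0] by simp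
next
  case (update f a b)
  have "Poly_Mapping.update a b f = Poly_Mapping.single a b + f"
    using update(1) by (intro poly_mapping_eqI)
      (auto simp: lookup_update lookup_add lookup_single_if in_keys_iff)
  then show ?case
    using assms update by simp
qed

lemma cst_simps: "cst z + cst z' = cst (z + z')" "cst z * cst z' = cst (z * z')"
    "- cst z = cst (- z)" "cst 1 = 1" "cst 0 = 0" "cst z - cst z' = cst (z - z')"
  by (simp_all add: cst_def single_add mult_single single_uminus single_diff)

lemma cst_commute: "x * cst z = cst z * x"
proof (induction x rule: free_induct)
  case (single v y)
  then show ?case
    by (simp add: cst_def mult_single mult.commute)
qed (simp add: algebra_simps)

lemma free_word_induct [case_names one gen cst add]:
  fixes x :: free
  assumes "P 1" and "\<And>g x. P x \<Longrightarrow> P (var g * x)" and "\<And>z x. P x \<Longrightarrow> P (cst z * x)"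
    and "\<And>x y. P x \<Longrightarrow> P y \<Longrightarrow> P (x + y)"
  shows "P x"
proof (induction x rule: free_induct)
  case (single v z)
  have "P (Poly_Mapping.single (Word l) 1)" for l
  proof (induction l)
    case Nil
    then show ?case
      using assms(1) by (simp flip: zero_word_def)
  next
    case (Cons g l)
    have "var g * Poly_Mapping.single (Word l) 1 = Poly_Mapping.single (Word (g # l)) 1"
      by (simp add: var_def mult_single plus_word_def)
    with assms(2)[OF Cons, of g] show ?case by simp
  qed
  from assms(3)[OF this[of "letters v"], of z] show ?case
    by (simp add: cst_def mult_single)
next
  case (add x y)
  then show ?case by (rule assms(4))
qed

context cube_root
begin

section \<open>The representation on tensors and the ideal it annihilates\<close>

primrec lmul :: "gen \<Rightarrow> tensor \<Rightarrow> tensor" where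
  "lmul E_a = wedge_a" | "lmul E_b = wedge_b" | "lmul E_c = wedge_c" | "lmul E_d = wedge_d"
| "lmul G_a = gen_a" | "lmul G_b = gen_b" | "lmul G_c = gen_c" | "lmul G_d = gen_d"

lemma lin_lmul: "lin (lmul g)"
  by (cases g) (simp_all add: lin_tables lin_gen)

definition word_act :: "word \<Rightarrow> tensor \<Rightarrow> tensor" where
  "word_act v = foldr lmul (letters v)"

definition act :: "free \<Rightarrow> tensor \<Rightarrow> tensor" where
  "act x w = (\<Sum>v\<in>Poly_Mapping.keys x. smul (Poly_Mapping.lookup x v) (word_act v w))"

lemma lin_word_act: "lin (word_act v)"
proof -
  have "lin (foldr lmul l)" for l
  proof (induction l)
    case (Cons g l)
    then show ?case
      using lin_lmul[of g] by (simp add: lin_def)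
  qed (simp add: lin_def)
  then show ?thesis by (simp add: word_act_def)
qed

lemmas word_act_lin = lin_word_act[THEN lin_add] lin_word_act[THEN lin_smul]

text \<open>Cancellation can shrink the support of a sum, so the sums for x, y and x + y are
  compared over a common larger index set.\<close>

lemma act_superset:
  assumes "finite S" "Poly_Mapping.keys x \<subseteq> S"
  shows "act x w = (\<Sum>v\<in>S. smul (Poly_Mapping.lookup x v) (word_act v w))"
  unfolding act_def using assms
  by (intro sum.mono_neutral_left) (auto simp: in_keys_iff)

lemma act_add: "act (x + y) w = act x w + act y w"
proof -
  let ?S = "Poly_Mapping.keys x \<union> Poly_Mapping.keys y"
  have "act (x + y) w = (\<Sum>v\<in>?S. smul (Poly_Mapping.lookup (x + y) v) (word_act v w))"
    by (intro act_superset) (simp_all add: Poly_Mapping.keys_add)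
  also have "\<dots> = (\<Sum>v\<in>?S. smul (Poly_Mapping.lookup x v) (word_act v w) +
      smul (Poly_Mapping.lookup y v) (word_act v w))"
    by (intro sum.cong refl tensor_eqI) (simp add: lookup_add algebra_simps)
  also have "\<dots> = act x w + act y w"
    by (simp add: sum.distrib act_superset[of ?S])
  finally show ?thesis .
qed

lemma act_single: "act (Poly_Mapping.single v z) w = smul z (word_act v w)"
  by (cases "z = 0") (simp_all add: act_def)

lemma act_zero: "act 0 w = 0"
  by (simp add: act_def)

lemma lin_act: "lin (act x)"
proof (induction x rule: free_induct)
  case (single v z)
  show ?case
    by (rule linI) (simp_all only: act_single word_act_lin smul_add smul_smul mult.commute)
next
  case (add x y)
  show ?case
    by (rule linI) (simp_all only: act_add add[THEN lin_add] add[THEN lin_smul] smul_add ac_simps)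
qed

lemma act_cst: "act (cst z) w = smul z w"
  by (simp add: cst_def act_single word_act_def zero_word_def)

lemma act_one: "act 1 w = w"
  using act_cst[of 1 w] by (simp add: cst_simps)

lemma act_var: "act (var g) w = lmul g w"
  by (simp add: var_def act_single word_act_def)

lemma word_act_plus: "word_act (u + v) w = word_act u (word_act v w)"
  by (simp add: word_act_def plus_word_def)

lemma act_mult: "act (x * y) w = act x (act y w)"
proof (induction x rule: free_induct)
  case (single v z)
  show ?case
  proof (induction y rule: free_induct)
    case (single u s)
    then show ?case
      by (simp only: mult_single act_single word_act_lin smul_smul word_act_plus)
  next
    case (add x y)
    then show ?case
      by (simp only: distrib_left act_add lin_act[THEN lin_add])
  qed
qed (simp add: distrib_right act_add)

lemma act_uminus: "act (- x) w = - act x w"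
proof -
  have "act (- x) w + act x w = 0"
    by (simp only: act_add[symmetric] left_minus act_zero)
  then show ?thesis
    by (simp only: eq_neg_iff_add_eq_0)
qed

lemma act_diff: "act (x - y) w = act x w - act y w"
  using act_add[of x "- y" w] by (simp add: act_uminus)

lemmas act_simps = act_add act_cst act_one act_var act_mult act_uminus act_diff act_zero

lemma q2: "q ^ 2 = - 1 - q"
  by (simp add: power2_eq_square qq)

lemma q_nz: "q \<noteq> 0"
  using cube by auto

lemma inverse_q: "inverse q = - 1 - q"
  by (rule inverse_unique) (simp add: qring)

lemma inverse_q2: "inverse (q ^ 2) = q"
  by (rule inverse_unique) (simp add: q2 qring)

lemma mu: "mu q = 1 - q"
  by (simp add: mu_def inverse_q2)

lemma ring_free: "ring free_ring"
  by (unfold_locales) (auto simp: free_ring_def algebra_simps Units_def intro!: exI[of _ "- x" for x])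

sublocale R: ring free_ring by (rule ring_free)

lemma relations_act:
  "\<forall>x \<in> relations_A q \<union> relations_Lambda q \<union> relations_cross q. act x w = 0"
  unfolding relations_A_def relations_Lambda_def relations_cross_def
  by (simp add: ball_Un act_simps power3_eq_cube gen_rels wedge_rels wedge_rels' gen_wedge_u gen_wedge_v mu
        inverse_q q2 power2_eq_square)
    (intro conjI tensor_eqI; simp add: qring)

lemma ideal_rel: "ideal (rel_ideal q) free_ring"
  unfolding rel_ideal_def by (rule R.genideal_ideal) (simp add: free_ring_def)

lemma relations_in: "relations_A q \<union> relations_Lambda q \<union> relations_cross q \<subseteq> rel_ideal q"
  unfolding rel_ideal_def by (rule R.genideal_self) (simp add: free_ring_def)

text \<open>The elements acting as zero form a two-sided ideal that contains the relations, hence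
  also the ideal generated by them.\<close>

lemma act_rel_ideal:
  assumes "x \<in> rel_ideal q"
  shows "act x w = 0"
proof -
  have "ideal {x. \<forall>w. act x w = 0} free_ring"
  proof (rule idealI[OF ring_free])
    show "subgroup {x. \<forall>w. act x w = 0} (add_monoid free_ring)"
    proof (rule R.add.subgroupI)
      fix x assume "x \<in> {x. \<forall>w. act x w = 0}"
      moreover have "\<ominus>\<^bsub>free_ring\<^esub> x = - x"
        by (rule R.minus_equality) (simp_all add: free_ring_def)
      ultimately show "\<ominus>\<^bsub>free_ring\<^esub> x \<in> {x. \<forall>w. act x w = 0}"
        by (simp add: act_uminus)
    qed (auto simp: free_ring_def act_add act_zero intro!: exI[of _ 0])
  qed (auto simp: free_ring_def act_mult lin_act[THEN lin_zero])
  then have "rel_ideal q \<subseteq> {x. \<forall>w. act x w = 0}"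
    unfolding rel_ideal_def by (rule R.genideal_minimal) (auto simp: relations_act)
  with assms show ?thesis by auto
qed

end

section \<open>Normal form\<close>

lemma UNIV_three: "UNIV = {T0, T1, T2}"
  using three.exhaust by auto

lemma UNIV_form: "UNIV = {F1, Fa, Fb, Fc, Fd, Fab, Fac, Fad, Fbc, Fbd, Fcd, Fabc, Fabd, Facd, Fbcd, Fabcd}"
  using form.exhaust by (auto intro: UNIV_eq_I)

instance three :: finite
  by standard (simp add: UNIV_three)

instance form :: finite
  by standard (simp add: UNIV_form)

lemma sum_three: "(\<Sum>i\<in>UNIV. f i) = f T0 + (f T1 + f T2)"
  by (simp add: UNIV_three)

lemma sum_form: "(\<Sum>I\<in>UNIV. f I) = f F1 + (f Fa + (f Fb + (f Fc + (f Fd + (f Fab + (f Fac + (f Fad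
  + (f Fbc + (f Fbd + (f Fcd + (f Fabc + (f Fabd + (f Facd + (f Fbcd + f Fabcd))))))))))))))"
  by (simp add: UNIV_form)

section \<open>Normal words and their linear combinations\<close>

primrec form_word :: "form \<Rightarrow> free" where
  "form_word F1 = 1"
| "form_word Fa = ea" | "form_word Fb = eb" | "form_word Fc = ec" | "form_word Fd = ed"
| "form_word Fab = ea * eb" | "form_word Fac = ea * ec" | "form_word Fad = ea * ed"
| "form_word Fbc = eb * ec" | "form_word Fbd = eb * ed" | "form_word Fcd = ec * ed"
| "form_word Fabc = ea * (eb * ec)" | "form_word Fabd = ea * (eb * ed)"
| "form_word Facd = ea * (ec * ed)" | "form_word Fbcd = eb * (ec * ed)"
| "form_word Fabcd = ea * (eb * (ec * ed))"

primrec pow3 :: "free \<Rightarrow> three \<Rightarrow> free" where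
  "pow3 x T0 = 1" | "pow3 x T1 = x" | "pow3 x T2 = x * x"

definition monomial :: "three \<Rightarrow> three \<Rightarrow> three \<Rightarrow> free" where
  "monomial m n k = pow3 ga m * (pow3 gb n * pow3 gc k)"

definition iota_A :: "coord \<Rightarrow> free" where
  "iota_A s = (\<Sum>m\<in>UNIV. \<Sum>n\<in>UNIV. \<Sum>k\<in>UNIV. cst (s m n k) * monomial m n k)"

definition iota :: "tensor \<Rightarrow> free" where
  "iota w = (\<Sum>I\<in>UNIV. form_word I * iota_A (w I))"

lemma iota_A_add: "iota_A (\<lambda>m n k. s m n k + t m n k) = iota_A s + iota_A t"
  by (simp only: iota_A_def cst_simps(1) [symmetric] distrib_right sum.distrib)

lemma iota_A_smul: "iota_A (\<lambda>m n k. z * s m n k) = cst z * iota_A s"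
  by (simp only: iota_A_def cst_simps(2) [symmetric] sum_distrib_left mult.assoc)

lemma iota_A_zero: "iota_A (\<lambda>m n k. 0) = 0" "iota_A 0 = 0"
  by (simp_all add: iota_A_def cst_simps)

lemma iota_add: "iota (v + w) = iota v + iota w"
  by (simp add: iota_def plus_fun_def iota_A_add sum.distrib distrib_left)

lemma iota_smul: "iota (smul z w) = cst z * iota w"
proof -
  have "form_word I * (cst z * y) = cst z * (form_word I * y)" for I y
    by (simp add: cst_commute[of "form_word I"] flip: mult.assoc)
  then show ?thesis
    by (simp add: iota_def smul_def iota_A_smul sum_distrib_left)
qed

lemma iota_zero: "iota 0 = 0"
  by (simp add: iota_def iota_A_zero)

definition supp :: "form set \<Rightarrow> tensor \<Rightarrow> bool" where
  "supp S w \<longleftrightarrow> (\<forall>I. I \<notin> S \<longrightarrow> w I = (\<lambda>m n k. 0))"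

abbreviation "forms1 \<equiv> {F1}"
abbreviation "forms_d \<equiv> {F1, Fd}"
abbreviation "forms_cd \<equiv> {F1, Fd, Fc, Fcd}"
abbreviation "forms_bcd \<equiv> {F1, Fd, Fc, Fcd, Fb, Fbd, Fbc, Fbcd}"

lemma all_form: "(\<forall>I. P I) \<longleftrightarrow> P F1 \<and> P Fa \<and> P Fb \<and> P Fc \<and> P Fd \<and> P Fab \<and> P Fac \<and> P Fad
  \<and> P Fbc \<and> P Fbd \<and> P Fcd \<and> P Fabc \<and> P Fabd \<and> P Facd \<and> P Fbcd \<and> P Fabcd"
proof -
  have "(\<forall>I. P I) \<longleftrightarrow> (\<forall>I\<in>UNIV. P I)" by simp
  then show ?thesis by (simp add: UNIV_form)
qed

context cube_root
begin

interpretation I: ideal "rel_ideal q" free_ring by (rule ideal_rel)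

section \<open>Congruence modulo the relations\<close>

definition eqv :: "free \<Rightarrow> free \<Rightarrow> bool" (infix \<open>\<approx>\<close> 50) where
  "x \<approx> y \<longleftrightarrow> x - y \<in> rel_ideal q"

lemma rel_add: "x \<in> rel_ideal q \<Longrightarrow> y \<in> rel_ideal q \<Longrightarrow> x + y \<in> rel_ideal q"
  using I.a_closed[of x y] by (simp add: free_ring_def)

lemma rel_mult_left: "x \<in> rel_ideal q \<Longrightarrow> y * x \<in> rel_ideal q"
  using I.I_l_closed[of x y] by (simp add: free_ring_def)

lemma rel_mult_right: "x \<in> rel_ideal q \<Longrightarrow> x * y \<in> rel_ideal q"
  using I.I_r_closed[of x y] by (simp add: free_ring_def)

lemma rel_zero: "0 \<in> rel_ideal q"
  using I.zero_closed by (simp add: free_ring_def)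

lemma eqv_refl [simp]: "x \<approx> x"
  by (simp add: eqv_def rel_zero)

lemma eqv_sym: "x \<approx> y \<Longrightarrow> y \<approx> x"
  using rel_mult_left[of "x - y" "- 1"] by (simp add: eqv_def)

lemma eqv_trans [trans]: "x \<approx> y \<Longrightarrow> y \<approx> z \<Longrightarrow> x \<approx> z"
  using rel_add[of "x - y" "y - z"] by (simp add: eqv_def)

lemma eqv_add: "x \<approx> y \<Longrightarrow> x' \<approx> y' \<Longrightarrow> x + x' \<approx> y + y'"
  using rel_add[of "x - y" "x' - y'"] by (simp add: eqv_def algebra_simps)

lemma eqv_left: "x \<approx> y \<Longrightarrow> z * x \<approx> z * y"
  using rel_mult_left[of "x - y" z] by (simp add: eqv_def algebra_simps)

lemma eqv_right: "x \<approx> y \<Longrightarrow> x * z \<approx> y * z"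
  using rel_mult_right[of "x - y" z] by (simp add: eqv_def algebra_simps)

lemma eqv_sum: "(\<And>i. i \<in> S \<Longrightarrow> f i \<approx> g i) \<Longrightarrow> (\<Sum>i\<in>S. f i) \<approx> (\<Sum>i\<in>S. g i)"
  by (induction S rule: infinite_finite_induct) (auto intro: eqv_add)

lemma eqv_act: "x \<approx> y \<Longrightarrow> act x w = act y w"
  using act_rel_ideal[of "x - y" w] by (simp add: eqv_def act_diff)

lemma eqvI: "x - y \<in> relations_A q \<union> relations_Lambda q \<union> relations_cross q \<Longrightarrow> x \<approx> y"
  using relations_in by (auto simp: eqv_def)

lemma cst_minus_1: "cst (- 1) * x = - x"
  by (simp add: cst_simps flip: cst_simps(3))

lemma cst_mult_mult: "cst y * (cst z * x) = cst (y * z) * x"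
  by (simp add: cst_simps flip: mult.assoc)

lemma A_eqv:
  "gb * ga \<approx> cst q * (ga * gb)"
  "gc * ga \<approx> cst q * (ga * gc)"
  "gc * gb \<approx> gb * gc"
  "ga * gd \<approx> 1 + cst (- 1 - q) * (gb * gc)"
  "ga * (ga * ga) \<approx> 1"
  "gb * (gb * gb) \<approx> 0"
  "gc * (gc * gc) \<approx> 0"
  by (rule eqvI; simp add: relations_A_def power3_eq_cube mult.assoc inverse_q algebra_simps)+

text \<open>The right-hand sides are in normal order and built from constants by sums and products,
  so that \<open>acts\<close> for them is assembled from \<open>acts_cst\<close>,
  \<open>acts_mult\<close> and \<open>acts_plus\<close>.\<close>

lemma Lambda_eqv:
  "ed * ed \<approx> 0" "ec * ec \<approx> 0" "eb * eb \<approx> 0"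
  "ed * ec \<approx> cst (- 1) * (ec * ed)"
  "ed * eb \<approx> cst (- 1) * (eb * ed)"
  "ec * eb \<approx> cst (- 1) * (eb * ec)"
  "ea * ea \<approx> cst (1 - q) * (eb * ec)"
  "ed * ea \<approx> cst (- 1) * (ea * ed) + cst (- 1) * (cst (1 - q) * (eb * ec))"
  "ec * ea \<approx> cst (- 1) * (cst (- 1 - q) * (ea * ec)) + cst (- 1) * (cst (1 - q) * (ec * ed))"
  by (rule eqvI; simp add: relations_Lambda_def mu q2 cst_minus_1 algebra_simps)+

text \<open>The relation carries q^2 at \<open>eb * ea\<close>; multiplying it by q, with q^3 = 1,
  solves for this product.\<close>

lemma Lambda_eqv_b_a: "eb * ea \<approx> cst q * (cst (- 1) * (ea * eb) + cst (1 - q) * (eb * ed))"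
proof -
  let ?r = "ea * eb + cst (q ^ 2) * eb * ea - cst (mu q) * eb * ed"
  have "cst q * ?r = eb * ea - cst q * (cst (- 1) * (ea * eb) + cst (1 - q) * (eb * ed))"
    using cube by (simp add: mu cst_minus_1 algebra_simps cst_mult_mult power2_eq_square power3_eq_cube cst_simps)
  moreover have "?r \<in> rel_ideal q"
    using relations_in by (auto simp: relations_Lambda_def)
  ultimately show ?thesis
    unfolding eqv_def by (metis rel_mult_left)
qed

lemma cross_eqv:
  "ga * ea \<approx> cst q * (ea * ga) + cst (1 - q) * (ec * gc) + cst (3 + 3 * q) * (ed * ga)"
  "gb * ea \<approx> cst q * (ea * gb) + cst (1 - q) * (ec * gd) + cst (3 + 3 * q) * (ed * gb)"
  "ga * eb \<approx> eb * ga + cst (1 + 2 * q) * (ed * gc)"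
  "gb * eb \<approx> eb * gb + cst (1 + 2 * q) * (ed * gd)"
  "ga * ec \<approx> ec * ga"
  "gb * ec \<approx> ec * gb"
  "ga * ed \<approx> cst (- 1 - q) * (ed * ga)"
  "gb * ed \<approx> cst (- 1 - q) * (ed * gb)"
  "gc * ea \<approx> cst (- 1 - q) * (ea * gc) + cst (1 - q) * (eb * ga)"
  "gd * ea \<approx> cst (- 1 - q) * (ea * gd) + cst (1 - q) * (eb * gb)"
  "gc * eb \<approx> eb * gc"
  "gd * eb \<approx> eb * gd"
  "gc * ec \<approx> ec * gc + cst (1 + 2 * q) * (ed * ga)"
  "gd * ec \<approx> ec * gd + cst (1 + 2 * q) * (ed * gb)"
  "gc * ed \<approx> cst q * (ed * gc)"
  "gd * ed \<approx> cst q * (ed * gd)"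
  by (rule eqvI; simp add: relations_cross_def mu q2 inverse_q power2_eq_square qring)+

text \<open>\<open>acts x w\<close> is extended from forms in \<open>e\<^sub>d\<close> to forms in \<open>e\<^sub>c, e\<^sub>d\<close>, then \<open>e\<^sub>b, e\<^sub>c, e\<^sub>d\<close>, then all forms: each
  defining relation moves a generator past the newly adjoined one, and the model satisfies the same
  relation.\<close>

definition acts :: "free \<Rightarrow> tensor \<Rightarrow> bool" where
  "acts x w \<longleftrightarrow> x * iota w \<approx> iota (act x w)"

lemma acts_add: "acts x v \<Longrightarrow> acts x w \<Longrightarrow> acts x (v + w)"
  by (simp add: acts_def iota_add lin_act[THEN lin_add] distrib_left eqv_add)

lemma acts_plus: "acts x w \<Longrightarrow> acts y w \<Longrightarrow> acts (x + y) w"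
  by (simp add: acts_def iota_add act_add distrib_right eqv_add)

lemma acts_mult: "acts y w \<Longrightarrow> acts x (act y w) \<Longrightarrow> acts (x * y) w"
  unfolding acts_def act_mult mult.assoc by (blast intro: eqv_trans eqv_left)

lemma acts_cst: "acts (cst z) w"
  by (simp add: acts_def iota_smul act_cst)

lemma acts_zero: "acts 0 w"
  by (simp add: acts_def iota_zero act_zero)

lemma acts_eqv: "x \<approx> y \<Longrightarrow> acts y w \<Longrightarrow> acts x w"
  unfolding acts_def by (metis eqv_act eqv_right eqv_trans)

text \<open>The inductive step: once a relation turns the product of two letters into y, it suffices
  to know how y and the inner letter act on the smaller form w. The model satisfies the same
  relation, so both sides meet in the action of y.\<close>

lemma acts_lmul:
  assumes "var g * var h \<approx> y" "acts y w" "acts (var h) w"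
  shows "acts (var g) (lmul h w)"
proof -
  have "var g * iota (lmul h w) \<approx> var g * (var h * iota w)"
    using assms(3) by (intro eqv_left eqv_sym[of _ "iota _"]) (simp add: acts_def act_var)
  also have "\<dots> \<approx> iota (act (var g * var h) w)"
    using acts_eqv[OF assms(1,2)] by (simp add: acts_def mult.assoc)
  finally show ?thesis by (simp add: acts_def act_simps)
qed

text \<open>A normal word either lacks the newly adjoined letter or begins with it, and on words
  lacking it the wedge just prepends it.\<close>

lemma supp_split:
  "supp forms_d w \<Longrightarrow> \<exists>u v. w = u + wedge_d v \<and> supp forms1 u \<and> supp forms1 v"
  "supp forms_cd w \<Longrightarrow> \<exists>u v. w = u + wedge_c v \<and> supp forms_d u \<and> supp forms_d v"
  "supp forms_bcd w \<Longrightarrow> \<exists>u v. w = u + wedge_b v \<and> supp forms_cd u \<and> supp forms_cd v"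
  "\<exists>u v. w = u + wedge_a v \<and> supp forms_bcd u \<and> supp forms_bcd v"
proof -
  show "\<exists>u v. w = u + wedge_d v \<and> supp forms1 u \<and> supp forms1 v" if "supp forms_d w"
    using that
    by (intro exI[of _ "\<lambda>I. if I \<in> forms1 then w I else (\<lambda>m n k. 0)"]
        exI[of _ "\<lambda>I. case I of F1 \<Rightarrow> w Fd | _ \<Rightarrow> (\<lambda>m n k. 0)"] conjI)
      (auto simp: supp_def all_form fun_eq_iff)
  show "\<exists>u v. w = u + wedge_c v \<and> supp forms_d u \<and> supp forms_d v" if "supp forms_cd w"
    using that
    by (intro exI[of _ "\<lambda>I. if I \<in> forms_d then w I else (\<lambda>m n k. 0)"]
        exI[of _ "\<lambda>I. case I of F1 \<Rightarrow> w Fc | Fd \<Rightarrow> w Fcd | _ \<Rightarrow> (\<lambda>m n k. 0)"] conjI)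
      (auto simp: supp_def all_form fun_eq_iff)
  show "\<exists>u v. w = u + wedge_b v \<and> supp forms_cd u \<and> supp forms_cd v" if "supp forms_bcd w"
    using that
    by (intro exI[of _ "\<lambda>I. if I \<in> forms_cd then w I else (\<lambda>m n k. 0)"]
        exI[of _ "\<lambda>I. case I of F1 \<Rightarrow> w Fb | Fc \<Rightarrow> w Fbc | Fd \<Rightarrow> w Fbd | Fcd \<Rightarrow> w Fbcd
          | _ \<Rightarrow> (\<lambda>m n k. 0)"] conjI)
      (auto simp: supp_def all_form fun_eq_iff)
  show "\<exists>u v. w = u + wedge_a v \<and> supp forms_bcd u \<and> supp forms_bcd v"
    by (intro exI[of _ "\<lambda>I. if I \<in> forms_bcd then w I else (\<lambda>m n k. 0)"]
        exI[of _ "\<lambda>I. case I of F1 \<Rightarrow> w Fa | Fb \<Rightarrow> w Fab | Fc \<Rightarrow> w Fac | Fd \<Rightarrow> w Fad | Fbc \<Rightarrow> w Fabc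
          | Fbd \<Rightarrow> w Fabd | Fcd \<Rightarrow> w Facd | Fbcd \<Rightarrow> w Fabcd | _ \<Rightarrow> (\<lambda>m n k. 0)"] conjI)
      (auto simp: supp_def all_form fun_eq_iff)
qed

lemma supp_wedge:
  "supp forms1 w \<Longrightarrow> supp forms_d (wedge_d w)"
  "supp forms_d w \<Longrightarrow> supp forms_d (wedge_d w)"
  "supp forms_cd w \<Longrightarrow> supp forms_cd (wedge_d w)"
  "supp forms_cd w \<Longrightarrow> supp forms_cd (wedge_c w)"
  "supp forms_bcd w \<Longrightarrow> supp forms_bcd (wedge_d w)"
  "supp forms_bcd w \<Longrightarrow> supp forms_bcd (wedge_c w)"
  "supp forms_bcd w \<Longrightarrow> supp forms_bcd (wedge_b w)"
  by (auto simp: supp_def all_form fun_eq_iff)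

text \<open>Prepending a letter that comes first in the normal order yields a normal word at once;
  this is the base of the induction.\<close>

lemma acts_ordered:
  "supp forms1 w \<Longrightarrow> acts ed w"
  "supp forms_d w \<Longrightarrow> acts ec w"
  "supp forms_cd w \<Longrightarrow> acts eb w"
  "supp forms_bcd w \<Longrightarrow> acts ea w"
  by (simp_all add: acts_def act_var iota_def sum_form supp_def all_form iota_A_zero algebra_simps)

lemma acts_d:
  assumes "supp forms_d w" shows "acts ed w"
proof -
  obtain u v where w: "w = u + wedge_d v" and u: "supp forms1 u" and v: "supp forms1 v"
    using supp_split(1)[OF assms] by blast
  have "acts ed (lmul E_d v)"
    by (rule acts_lmul[OF Lambda_eqv(1) acts_zero acts_ordered(1)[OF v]])
  with acts_ordered(1)[OF u] show ?thesis
    unfolding w lmul.simps by (rule acts_add)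
qed

text \<open>The relation moves e_d inward past e_c. There it meets a form without e_c, and e_c is
  then applied to a form that still lacks e_c. The next two lemmas repeat this for e_b and
  e_a.\<close>

lemma acts_cd:
  assumes "supp forms_cd w" shows "acts ec w" "acts ed w"
proof -
  obtain u v where w: "w = u + wedge_c v" and u: "supp forms_d u" and v: "supp forms_d v"
    using supp_split(2)[OF assms] by blast
  have "acts ec (lmul E_c v)" "acts ed (lmul E_c v)"
    by (rule acts_lmul[OF Lambda_eqv(2)] acts_lmul[OF Lambda_eqv(4)];
        simp add: acts_zero acts_mult acts_cst acts_d acts_ordered(2) supp_wedge act_var v)+
  with u show "acts ec w" "acts ed w"
    unfolding w lmul.simps by (blast intro: acts_add acts_d acts_ordered(2))+
qed

lemma acts_bcd:
  assumes "supp forms_bcd w" shows "acts eb w" "acts ec w" "acts ed w"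
proof -
  obtain u v where w: "w = u + wedge_b v" and u: "supp forms_cd u" and v: "supp forms_cd v"
    using supp_split(3)[OF assms] by blast
  have "acts eb (lmul E_b v)" "acts ec (lmul E_b v)" "acts ed (lmul E_b v)"
    by (rule acts_lmul[OF Lambda_eqv(3)] acts_lmul[OF Lambda_eqv(6)] acts_lmul[OF Lambda_eqv(5)];
        simp add: acts_zero acts_mult acts_cst acts_cd acts_ordered(3) supp_wedge act_var v)+
  with u show "acts eb w" "acts ec w" "acts ed w"
    unfolding w lmul.simps by (blast intro: acts_add acts_cd acts_ordered(3))+
qed

lemma acts_e: "acts ea w" "acts eb w" "acts ec w" "acts ed w"
proof -
  obtain u v where w: "w = u + wedge_a v" and u: "supp forms_bcd u" and v: "supp forms_bcd v"
    using supp_split(4) by blast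
  have "acts ea (lmul E_a v)" "acts ed (lmul E_a v)" "acts ec (lmul E_a v)" "acts eb (lmul E_a v)"
    by (rule acts_lmul[OF Lambda_eqv(7)] acts_lmul[OF Lambda_eqv(8)] acts_lmul[OF Lambda_eqv(9)]
        acts_lmul[OF Lambda_eqv_b_a];
        simp add: acts_mult acts_plus acts_cst acts_bcd acts_ordered(4) supp_wedge act_var v)+
  with u show "acts ea w" "acts eb w" "acts ec w" "acts ed w"
    unfolding w lmul.simps by (blast intro: acts_add acts_bcd acts_ordered(4))+
qed

text \<open>Moving one generator of A past an e produces others, c from a and d from b, and
  conversely; hence all four are treated together.\<close>

lemma acts_A_wedge:
  assumes "acts ga w" "acts gb w" "acts gc w" "acts gd w"
  shows "acts ga (lmul E_a w)" "acts gb (lmul E_a w)" "acts gc (lmul E_a w)" "acts gd (lmul E_a w)"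
    "acts ga (lmul E_b w)" "acts gb (lmul E_b w)" "acts gc (lmul E_b w)" "acts gd (lmul E_b w)"
    "acts ga (lmul E_c w)" "acts gb (lmul E_c w)" "acts gc (lmul E_c w)" "acts gd (lmul E_c w)"
    "acts ga (lmul E_d w)" "acts gb (lmul E_d w)" "acts gc (lmul E_d w)" "acts gd (lmul E_d w)"
  by (rule cross_eqv[THEN acts_lmul]; simp add: acts_plus acts_mult acts_cst acts_e assms)+

section \<open>Left multiplication on the monomials of A\<close>

lemma ga_mono: "ga * monomial m n k \<approx> monomial (succ3 m) n k"
  using eqv_right[OF A_eqv(5), of "pow3 gb n * pow3 gc k"]
  by (cases m) (simp_all add: monomial_def mult.assoc)

lemma past_ga:
  assumes "x * ga \<approx> cst q * (ga * x)"
  shows "x * pow3 ga m \<approx> cst (wt m) * (pow3 ga m * x)"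
proof (cases m)
  case T2
  have "x * (ga * ga) \<approx> cst q * (ga * (x * ga))"
    using eqv_right[OF assms, of ga] by (simp add: mult.assoc)
  also have "\<dots> \<approx> cst q * (ga * (cst q * (ga * x)))"
    by (intro eqv_left assms)
  also have "\<dots> = cst (q * q) * (ga * ga * x)"
    using cst_commute[of ga q] by (simp add: mult.assoc flip: cst_simps(2)) (simp flip: mult.assoc)
  finally show ?thesis by (simp add: T2 qq)
qed (use assms in \<open>simp_all add: cst_simps\<close>)

primrec next_mono :: "three \<Rightarrow> free \<Rightarrow> free" where
  "next_mono T0 x = x" | "next_mono T1 x = x * x" | "next_mono T2 x = 0"

lemma gc_gb: "gc * pow3 gb n \<approx> pow3 gb n * gc"
proof (cases n)
  case T2
  have "gc * (gb * gb) \<approx> gb * (gc * gb)"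
    using eqv_right[OF A_eqv(3), of gb] by (simp add: mult.assoc)
  also have "\<dots> \<approx> gb * (gb * gc)"
    by (intro eqv_left A_eqv)
  finally show ?thesis by (simp add: T2 mult.assoc)
qed (use A_eqv(3) in simp_all)

lemma next_pow3: "x * (x * x) \<approx> 0 \<Longrightarrow> x * pow3 x n \<approx> next_mono n x"
  by (cases n) simp_all

lemma gb_mono: "gb * monomial m n k \<approx> cst (wt m) * (pow3 ga m * (next_mono n gb * pow3 gc k))"
proof -
  have "gb * monomial m n k \<approx> cst (wt m) * (pow3 ga m * ((gb * pow3 gb n) * pow3 gc k))"
    using eqv_right[OF past_ga[OF A_eqv(1), of m], of "pow3 gb n * pow3 gc k"]
    by (simp add: monomial_def mult.assoc)
  also have "\<dots> \<approx> cst (wt m) * (pow3 ga m * (next_mono n gb * pow3 gc k))"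
    by (intro eqv_left eqv_right next_pow3 A_eqv)
  finally show ?thesis .
qed

lemma gc_mono: "gc * monomial m n k \<approx> cst (wt m) * (pow3 ga m * (pow3 gb n * next_mono k gc))"
proof -
  have "gc * monomial m n k \<approx> cst (wt m) * (pow3 ga m * ((gc * pow3 gb n) * pow3 gc k))"
    using eqv_right[OF past_ga[OF A_eqv(2), of m], of "pow3 gb n * pow3 gc k"]
    by (simp add: monomial_def mult.assoc)
  also have "\<dots> \<approx> cst (wt m) * (pow3 ga m * ((pow3 gb n * gc) * pow3 gc k))"
    by (intro eqv_left eqv_right gc_gb)
  also have "\<dots> \<approx> cst (wt m) * (pow3 ga m * (pow3 gb n * next_mono k gc))"
    unfolding mult.assoc by (intro eqv_left next_pow3 A_eqv)
  finally show ?thesis .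
qed

lemma mult_iota_A: "x * iota_A s = (\<Sum>m\<in>UNIV. \<Sum>n\<in>UNIV. \<Sum>k\<in>UNIV. cst (s m n k) * (x * monomial m n k))"
  unfolding iota_A_def sum_distrib_left
  by (intro sum.cong refl) (metis cst_commute mult.assoc)

lemma left_iota_A:
  "ga * iota_A (w I) \<approx> iota_A (left_a w I)"
  "gb * iota_A (w I) \<approx> iota_A (left_b w I)"
  "gc * iota_A (w I) \<approx> iota_A (left_c w I)"
proof -
  have "ga * iota_A (w I) \<approx> (\<Sum>m\<in>UNIV. \<Sum>n\<in>UNIV. \<Sum>k\<in>UNIV. cst (w I m n k) * monomial (succ3 m) n k)"
    unfolding mult_iota_A by (intro eqv_sum eqv_left ga_mono)
  also have "\<dots> = iota_A (left_a w I)"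
    by (simp add: iota_A_def left_a_def sum_three ac_simps)
  finally show "ga * iota_A (w I) \<approx> iota_A (left_a w I)" .
  have "gb * iota_A (w I) \<approx> (\<Sum>m\<in>UNIV. \<Sum>n\<in>UNIV. \<Sum>k\<in>UNIV. cst (w I m n k) *
      (cst (wt m) * (pow3 ga m * (next_mono n gb * pow3 gc k))))"
    unfolding mult_iota_A by (intro eqv_sum eqv_left gb_mono)
  also have "\<dots> = iota_A (left_b w I)"
    by (simp add: iota_A_def left_b_def sum_three monomial_def cst_mult_mult mult.commute cst_simps)
  finally show "gb * iota_A (w I) \<approx> iota_A (left_b w I)" .
  have "gc * iota_A (w I) \<approx> (\<Sum>m\<in>UNIV. \<Sum>n\<in>UNIV. \<Sum>k\<in>UNIV. cst (w I m n k) *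
      (cst (wt m) * (pow3 ga m * (pow3 gb n * next_mono k gc))))"
    unfolding mult_iota_A by (intro eqv_sum eqv_left gc_mono)
  also have "\<dots> = iota_A (left_c w I)"
    by (simp add: iota_A_def left_c_def sum_three monomial_def cst_mult_mult mult.commute cst_simps)
  finally show "gc * iota_A (w I) \<approx> iota_A (left_c w I)" .
qed

text \<open>Since a^3 = 1, d equals a^2 (a d), and the determinant relation rewrites a d. This
  eliminates d in favour of a, b, c.\<close>

lemma gd_eqv: "gd \<approx> ga * (ga * (1 + cst (- 1 - q) * (gb * gc)))"
proof -
  have "gd \<approx> (ga * (ga * ga)) * gd"
    using eqv_sym[OF eqv_right[OF A_eqv(5), of gd]] by simp
  also have "\<dots> = ga * (ga * (ga * gd))"
    by (simp add: mult.assoc)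
  also have "\<dots> \<approx> ga * (ga * (1 + cst (- 1 - q) * (gb * gc)))"
    by (intro eqv_left A_eqv)
  finally show ?thesis .
qed

lemma supp_forms1: "supp forms1 w \<Longrightarrow> iota w = iota_A (w F1)"
  by (simp add: iota_def sum_form supp_def all_form iota_A_zero)

lemma supp_left:
  assumes "supp S w"
  shows "supp S (left_a w)" "supp S (left_b w)" "supp S (left_c w)"
  using assms by (auto simp: supp_def left_a_def left_b_def left_c_def fun_eq_iff)

lemma supp_linear:
  "supp S v \<Longrightarrow> supp S w \<Longrightarrow> supp S (v + w)" "supp S w \<Longrightarrow> supp S (smul z w)"
  by (auto simp: supp_def fun_eq_iff)

text \<open>On degree 0 the twist matrix is the identity, that is, the counit representation, so the
  coproduct collapses to its second factor.\<close>

lemma gen_forms1: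
  assumes "supp forms1 w"
  shows "gen_a w = left_a w" "gen_b w = left_b w" "gen_c w = left_c w" "gen_d w = left_d w"
proof -
  have "twist_uu w = w" "twist_uv w = 0" "twist_vu w = 0" "twist_vv w = w"
    using assms by (auto simp: supp_def all_form fun_eq_iff)
  then show "gen_a w = left_a w" "gen_b w = left_b w" "gen_c w = left_c w" "gen_d w = left_d w"
    by (simp_all add: gen_defs lin_simps)
qed

lemma acts_A_forms1:
  assumes w: "supp forms1 w"
  shows "acts ga w" "acts gb w" "acts gc w" "acts gd w"
proof -
  have *: "acts ga v" "acts gb v" "acts gc v" if "supp forms1 v" for v
    using that by (simp_all add: acts_def act_var gen_forms1 supp_left supp_forms1 left_iota_A)
  from w show "acts ga w" "acts gb w" "acts gc w"
    by (rule *)+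
  \<comment> \<open>The word replacing d is applied letter by letter. Each intermediate result is
    again a function, so \<open>*\<close> applies at every stage.\<close>
  have "supp forms1 (act (1 + cst (- 1 - q) * (gb * gc)) w)" "supp forms1 (act (gb * gc) w)"
    by (simp_all add: act_simps gen_forms1 supp_left supp_linear w)
  moreover have "acts 1 w"
    using acts_cst[of 1] by (simp add: cst_simps)
  ultimately show "acts gd w"
    by (intro acts_eqv[OF gd_eqv] acts_mult acts_plus acts_cst *)
      (simp_all add: act_var act_mult gen_forms1 supp_left supp_linear w)
qed

definition acts_A :: "tensor \<Rightarrow> bool" where
  "acts_A w \<longleftrightarrow> acts ga w \<and> acts gb w \<and> acts gc w \<and> acts gd w"

lemma acts_A: "acts_A w"
proof -
  have add: "acts_A (v + w)" if "acts_A v" "acts_A w" for v w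
    using that by (simp add: acts_A_def acts_add)
  have wedge: "acts_A (wedge_a w)" "acts_A (wedge_b w)" "acts_A (wedge_c w)" "acts_A (wedge_d w)"
    if "acts_A w" for w
    using that acts_A_wedge[of w] by (simp_all add: acts_A_def)
  have 1: "acts_A w" if "supp forms1 w" for w
    using acts_A_forms1[OF that] by (simp add: acts_A_def)
  have 2: "acts_A w" if "supp forms_d w" for w
    using supp_split(1)[OF that] by (auto intro: add wedge 1)
  have 3: "acts_A w" if "supp forms_cd w" for w
    using supp_split(2)[OF that] by (auto intro: add wedge 2)
  have 4: "acts_A w" if "supp forms_bcd w" for w
    using supp_split(3)[OF that] by (auto intro: add wedge 3)
  show ?thesis
    using supp_split(4)[of w] by (auto intro: add wedge 4)
qed

lemma acts_var: "acts (var g) w"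
  using acts_A[of w] by (cases g) (auto simp: acts_A_def acts_e)

lemma acts: "acts x w"
proof (induction x rule: free_word_induct)
  case one
  then show ?case
    using acts_cst[of 1] by (simp add: cst_simps)
qed (auto intro: acts_mult acts_var acts_cst acts_plus)

section \<open>Coordinates of a class\<close>

definition unit :: "three \<Rightarrow> three \<Rightarrow> three \<Rightarrow> tensor" where
  "unit m n k = (\<lambda>I m' n' k'. if I = F1 \<and> m' = m \<and> n' = n \<and> k' = k then 1 else 0)"

text \<open>The tensor \<open>unit T0 T0 T0\<close> represents 1, so this is the value of left
  multiplication by x at 1.\<close>

definition coords :: "free \<Rightarrow> tensor" where
  "coords x = act x (unit T0 T0 T0)"

lemma iota_coords: "iota (coords x) \<approx> x"
proof -
  have "iota (unit T0 T0 T0) = 1"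
    by (simp add: iota_def iota_A_def sum_form sum_three unit_def monomial_def cst_simps)
  then show ?thesis
    using acts[of x "unit T0 T0 T0"] by (auto simp: acts_def coords_def intro: eqv_sym)
qed

lemma coords_eq_iff: "coords x = coords y \<longleftrightarrow> x \<approx> y"
proof
  assume "coords x = coords y"
  then show "x \<approx> y"
    using iota_coords[of x] iota_coords[of y] eqv_sym eqv_trans by metis
qed (simp add: coords_def eqv_act)

lemma supp_unit: "supp forms1 (unit m n k)"
  by (simp add: supp_def unit_def)

text \<open>Monomials are built from the right, c before b before a, so b and c meet only the
  exponent \<open>T0\<close> of a, where the weight is 1.\<close>

lemma left_unit:
  "left_a (unit m n k) = unit (succ3 m) n k"
  "left_b (unit T0 T0 k) = unit T0 T1 k" "left_b (unit T0 T1 k) = unit T0 T2 k"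
  "left_c (unit T0 n T0) = unit T0 n T1" "left_c (unit T0 n T1) = unit T0 n T2"
proof -
  have pred3: "pred3 i = j \<longleftrightarrow> i = succ3 j" for i j
    by (cases i; cases j) auto
  show "left_a (unit m n k) = unit (succ3 m) n k"
    by (simp add: left_a_def unit_def pred3)
  show "left_b (unit T0 T0 k) = unit T0 T1 k" "left_b (unit T0 T1 k) = unit T0 T2 k"
    by (intro tensor_eqI; rename_tac I m' n' k'; case_tac n'; case_tac m'; simp add: left_b_def unit_def)+
  show "left_c (unit T0 n T0) = unit T0 n T1" "left_c (unit T0 n T1) = unit T0 n T2"
    by (intro tensor_eqI; rename_tac I m' n' k'; case_tac k'; case_tac m'; simp add: left_c_def unit_def)+
qed

lemma act_monomial: "act (monomial m n k) (unit T0 T0 T0) = unit m n k"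
  by (cases m; cases n; cases k;
      simp only: monomial_def pow3.simps act_simps lmul.simps gen_forms1[OF supp_unit] left_unit succ3.simps)

lemma act_sum: "act (\<Sum>i\<in>S. f i) w = (\<Sum>i\<in>S. act (f i) w)"
  by (induction S rule: infinite_finite_induct) (simp_all add: act_zero act_add)

definition embed :: "coord \<Rightarrow> tensor" where
  "embed s = (\<lambda>I. if I = F1 then s else (\<lambda>m n k. 0))"

lemma unit_apply: "unit m n k I m' n' k' = (if I = F1 \<and> m' = m \<and> n' = n \<and> k' = k then 1 else 0)"
  by (simp add: unit_def)

lemma coords_iota_A: "coords (iota_A s) = embed s"
  unfolding coords_def iota_A_def
  by (rule tensor_eqI, rename_tac I m n k, case_tac m; case_tac n; case_tac k;
      simp add: sum_three act_add act_mult act_cst act_monomial unit_apply embed_def)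

lemma act_form_word: "act (form_word I) (embed s) = (\<lambda>J. if J = I then s else (\<lambda>m n k. 0))"
  by (cases I; rule tensor_eqI, rename_tac J m n k, case_tac J; simp add: act_simps embed_def)

text \<open>Normal words have the standard basis vectors as coordinates, so they are independent
  modulo the relations. Together with \<open>iota_coords\<close> this makes \<open>coords\<close> a
  bijection from classes to tensors.\<close>

lemma coords_iota: "coords (iota w) = w"
proof -
  have "coords (iota w) = (\<Sum>I\<in>UNIV. act (form_word I) (embed (w I)))"
    by (simp only: coords_def iota_def act_sum act_mult flip: coords_iota_A)
  also have "\<dots> = w"
    by (rule tensor_eqI, rename_tac I m n k, case_tac I; simp add: act_form_word sum_form)
  finally show ?thesis .
qed

end

section \<open>Transport to \<open>\<Omega>\<close>\<close>

primrec fdeg :: "form \<Rightarrow> nat" where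
  "fdeg F1 = 0" | "fdeg Fa = 1" | "fdeg Fb = 1" | "fdeg Fc = 1" | "fdeg Fd = 1"
| "fdeg Fab = 2" | "fdeg Fac = 2" | "fdeg Fad = 2" | "fdeg Fbc = 2" | "fdeg Fbd = 2" | "fdeg Fcd = 2"
| "fdeg Fabc = 3" | "fdeg Fabd = 3" | "fdeg Facd = 3" | "fdeg Fbcd = 3" | "fdeg Fabcd = 4"

definition homogeneous :: "nat \<Rightarrow> free \<Rightarrow> bool" where
  "homogeneous i x \<longleftrightarrow> (\<forall>w \<in> Poly_Mapping.keys x. form_degree w = i)"

definition has_deg :: "nat \<Rightarrow> tensor \<Rightarrow> bool" where
  "has_deg i w \<longleftrightarrow> supp {I. fdeg I = i} w"

lemma has_deg_iff: "has_deg i w \<longleftrightarrow> (\<forall>I. fdeg I \<noteq> i \<longrightarrow> w I = (\<lambda>m n k. 0))"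
  by (simp add: has_deg_def supp_def)

lemma homogeneous_mult: "homogeneous i x \<Longrightarrow> homogeneous j y \<Longrightarrow> homogeneous (i + j) (x * y)"
  using keys_mult[of x y] by (fastforce simp: homogeneous_def form_degree_def plus_word_def)

lemma homogeneous_add: "homogeneous i x \<Longrightarrow> homogeneous i y \<Longrightarrow> homogeneous i (x + y)"
  using Poly_Mapping.keys_add[of x y] by (fastforce simp: homogeneous_def)

lemma homogeneous_uminus: "homogeneous i x \<Longrightarrow> homogeneous i (- x)"
  by (simp add: homogeneous_def in_keys_iff)

lemma homogeneous_cst: "homogeneous 0 (cst z)" "homogeneous 0 1" "homogeneous i 0"
  by (simp_all add: homogeneous_def cst_def form_degree_def zero_word_def)

lemma homogeneous_var:
  "homogeneous 1 ea" "homogeneous 1 eb" "homogeneous 1 ec" "homogeneous 1 ed"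
  "homogeneous 0 ga" "homogeneous 0 gb" "homogeneous 0 gc" "homogeneous 0 gd"
  by (simp_all add: homogeneous_def var_def form_degree_def)

lemma homogeneous_mult_0: "homogeneous 0 x \<Longrightarrow> homogeneous i y \<Longrightarrow> homogeneous i (x * y)"
    "homogeneous i x \<Longrightarrow> homogeneous 0 y \<Longrightarrow> homogeneous i (x * y)"
  using homogeneous_mult[of 0 x i y] homogeneous_mult[of i x 0 y] by simp_all

lemma homogeneous_sum: "(\<And>i. i \<in> S \<Longrightarrow> homogeneous j (f i)) \<Longrightarrow> homogeneous j (\<Sum>i\<in>S. f i)"
  by (induction S rule: infinite_finite_induct) (auto intro: homogeneous_add homogeneous_cst)

lemma homogeneous_form_word: "homogeneous (fdeg I) (form_word I)"
  using homogeneous_mult[OF homogeneous_var(1), of 1] homogeneous_mult[OF homogeneous_var(2), of 1]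
    homogeneous_mult[OF homogeneous_var(3), of 1] homogeneous_mult[OF homogeneous_var(1), of 2]
    homogeneous_mult[OF homogeneous_var(2), of 2] homogeneous_mult[OF homogeneous_var(1), of 3]
  by (cases I) (simp_all add: homogeneous_var[simplified] homogeneous_cst numeral_eq_Suc)

lemma homogeneous_iota_A: "homogeneous 0 (iota_A s)"
proof -
  have "homogeneous 0 (pow3 x n)" if "homogeneous 0 x" for x n
    using that by (cases n) (auto intro: homogeneous_cst homogeneous_mult_0)
  then show ?thesis
    unfolding iota_A_def monomial_def
    by (intro homogeneous_sum homogeneous_mult_0 homogeneous_cst) (auto intro: homogeneous_var)
qed

lemma homogeneous_iota: "has_deg i w \<Longrightarrow> homogeneous i (iota w)"
  unfolding iota_def
proof (rule homogeneous_sum)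
  fix I assume "has_deg i w"
  then show "homogeneous i (form_word I * iota_A (w I))"
    using homogeneous_form_word[of I] homogeneous_iota_A[of "w I"]
    by (cases "fdeg I = i") (auto simp: has_deg_iff iota_A_zero homogeneous_cst intro: homogeneous_mult_0)
qed

context cube_root
begin

lemma has_deg_lmul:
  assumes "has_deg i w"
  shows "has_deg ((if g \<in> {E_a, E_b, E_c, E_d} then 1 else 0) + i) (lmul g w)"
proof (cases "g \<in> {E_a, E_b, E_c, E_d}")
  case True
  have w: "w I = (\<lambda>m n k. 0)" if "fdeg I \<noteq> i" for I
    using assms that by (simp add: has_deg_iff)
  have "lmul g w I m n k = 0" if "fdeg I \<noteq> Suc i" for I m n k
    using True that by (elim insertE emptyE; cases I; simp add: w)
  with True show ?thesis
    by (simp add: has_deg_iff fun_eq_iff)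
next
  case False
  have twist: "has_deg i (twist_uu w)" "has_deg i (twist_uv w)" "has_deg i (twist_vu w)" "has_deg i (twist_vv w)"
  proof -
    have w: "w I = (\<lambda>m n k. 0)" if "fdeg I \<noteq> i" for I
      using assms that by (simp add: has_deg_iff)
    have "twist_uu w I m n k = 0" "twist_uv w I m n k = 0" "twist_vu w I m n k = 0" "twist_vv w I m n k = 0"
      if "fdeg I \<noteq> i" for I m n k
      using that by (cases I; simp add: w)+
    then show "has_deg i (twist_uu w)" "has_deg i (twist_uv w)" "has_deg i (twist_vu w)" "has_deg i (twist_vv w)"
      by (simp_all add: has_deg_iff fun_eq_iff)
  qed
  have left: "has_deg i (left_a v)" "has_deg i (left_b v)" "has_deg i (left_c v)" "has_deg i (left_d v)"
    if "has_deg i v" for v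
    using that by (auto simp: has_deg_def left_d_def intro!: supp_linear supp_left)
  have "has_deg i (gen_a w)" "has_deg i (gen_b w)" "has_deg i (gen_c w)" "has_deg i (gen_d w)"
    unfolding gen_defs using left[OF twist(1)] left[OF twist(2)] left[OF twist(3)] left[OF twist(4)]
    by (simp_all only: has_deg_def supp_linear(1))
  with False show ?thesis
    by (cases g) simp_all
qed

lemma has_deg_coords:
  assumes "homogeneous i x"
  shows "has_deg i (coords x)"
proof -
  have *: "has_deg (length (filter (\<lambda>g. g \<in> {E_a, E_b, E_c, E_d}) l)) (foldr lmul l (unit T0 T0 T0))" for l
  proof (induction l)
    case Nil
    then show ?case
      by (auto simp: has_deg_iff unit_def fun_eq_iff)
  next
    case (Cons g l)
    from has_deg_lmul[OF this, of g] show ?case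
      by (cases "g \<in> {E_a, E_b, E_c, E_d}")
        (simp_all only: filter.simps list.size foldr.simps o_apply if_True if_False add_0 add.commute One_nat_def)
  qed
  have "has_deg i (word_act v (unit T0 T0 T0))" if "v \<in> Poly_Mapping.keys x" for v
    using that assms *[of "letters v"] by (auto simp: homogeneous_def form_degree_def word_act_def)
  then have deg: "supp {I. fdeg I = i} (smul z (word_act v (unit T0 T0 T0)))"
    if "v \<in> Poly_Mapping.keys x" for z v
    using that by (simp only: has_deg_def supp_linear(2))
  have "supp {I. fdeg I = i} (\<Sum>v\<in>S. f v)" if "\<And>v. v \<in> S \<Longrightarrow> supp {I. fdeg I = i} (f v)" for S f
    using that
  proof (induction S rule: infinite_finite_induct)
    case (insert v S)
    show ?case
      unfolding sum.insert[OF insert.hyps(1,2)]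
      by (rule supp_linear(1)) (use insert in auto)
  qed (simp_all add: supp_def fun_eq_iff)
  then show ?thesis
    unfolding coords_def act_def has_deg_def using deg by this
qed

interpretation I: ideal "rel_ideal q" free_ring by (rule ideal_rel)
interpretation Om: ring "Omega q" unfolding Omega_def by (rule I.quotient_is_ring)

section \<open>The quotient ring through representatives\<close>

lemma ring_Omega: "ring (Omega q)" by (rule Om.ring_axioms)

lemma carrier_free: "x \<in> carrier free_ring"
  by (simp add: free_ring_def)

lemma carrier_Omega: "carrier (Omega q) = range (cls q)"
  by (auto simp: Omega_def FactRing_def A_RCOSETS_def' cls_def free_ring_def)

lemma cls_carrier [simp]: "cls q x \<in> carrier (Omega q)"
  by (simp add: carrier_Omega)

lemma cls_mult: "cls q x \<otimes>\<^bsub>Omega q\<^esub> cls q y = cls q (x * y)"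
  using I.rcoset_mult_add[OF carrier_free carrier_free, of x y]
  by (simp add: Omega_def FactRing_def cls_def free_ring_def)

lemma cls_add: "cls q x \<oplus>\<^bsub>Omega q\<^esub> cls q y = cls q (x + y)"
  using I.a_rcos_sum[OF carrier_free carrier_free, of x y]
  by (simp add: Omega_def FactRing_def cls_def free_ring_def)

lemma cls_eq_iff: "cls q x = cls q y \<longleftrightarrow> x \<approx> y"
proof -
  have "x \<ominus>\<^bsub>free_ring\<^esub> y = x - y"
  proof -
    have "\<ominus>\<^bsub>free_ring\<^esub> y = - y"
      by (rule R.minus_equality) (simp_all add: free_ring_def)
    then show ?thesis by (simp add: a_minus_def) (simp add: free_ring_def)
  qed
  then show ?thesis
    using R.quotient_eq_iff_same_a_r_cos[OF ideal_rel carrier_free carrier_free, of x y]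
    by (simp add: cls_def eqv_def)
qed

lemma cls_zero: "\<zero>\<^bsub>Omega q\<^esub> = cls q 0"
proof -
  have "cls q 0 \<oplus>\<^bsub>Omega q\<^esub> cls q 0 = cls q 0"
    by (simp add: cls_add)
  then show ?thesis
    by (metis Om.add.r_cancel_one cls_carrier)
qed

lemma cls_uminus: "\<ominus>\<^bsub>Omega q\<^esub> cls q x = cls q (- x)"
  by (rule Om.minus_equality) (simp_all add: cls_add cls_zero)

lemma cls_diff: "cls q x \<ominus>\<^bsub>Omega q\<^esub> cls q y = cls q (x - y)"
  by (simp add: a_minus_def cls_uminus cls_add)

lemmas cls_simps = cls_mult cls_add cls_zero cls_uminus cls_diff

lemma cls_coords: "cls q x = cls q y \<longleftrightarrow> coords x = coords y"
  by (simp add: cls_eq_iff coords_eq_iff)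

text \<open>The inverse of the coordinate bijection; operators on \<Omega> are transported along
  it.\<close>

definition form_of :: "tensor \<Rightarrow> free set" where
  "form_of w = cls q (iota w)"

lemma form_of_coords: "form_of (coords x) = cls q x"
  by (simp add: form_of_def cls_coords coords_iota)

lemma form_of_eq_iff: "form_of v = form_of w \<longleftrightarrow> v = w"
  by (simp add: form_of_def cls_coords coords_iota)

lemma form_of_add: "form_of (v + w) = form_of v \<oplus>\<^bsub>Omega q\<^esub> form_of w"
  by (simp add: form_of_def iota_add cls_add)

lemma Omega_deg_eq: "Omega_deg q i = form_of ` {w. has_deg i w}"
proof -
  have "cls q x \<in> form_of ` {w. has_deg i w}" if "homogeneous i x" for x
    using has_deg_coords[OF that] by (auto simp flip: form_of_coords)
  moreover have "form_of w \<in> cls q ` {x. homogeneous i x}" if "has_deg i w" for w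
    using homogeneous_iota[OF that] by (auto simp: form_of_def)
  ultimately show ?thesis
    by (auto simp: Omega_deg_def homogeneous_def)
qed

lemma coords_simps: "coords (x + y) = coords x + coords y" "coords (x - y) = coords x - coords y"
  "coords (- x) = - coords x" "coords (cst z * x) = smul z (coords x)" "coords (var g * x) = lmul g (coords x)"
  by (simp_all add: coords_def act_simps)

section \<open>Right multiplication by \<theta> and the exterior derivative\<close>

lemma rt_comm:
  "rt_a (wedge_a w) = wedge_a (rt_a w)" "rt_a (wedge_b w) = wedge_b (rt_a w)"
  "rt_a (wedge_c w) = wedge_c (rt_a w)" "rt_a (wedge_d w) = wedge_d (rt_a w)"
  "rt_b (wedge_a w) = wedge_a (rt_b w)" "rt_b (wedge_b w) = wedge_b (rt_b w)"
  "rt_b (wedge_c w) = wedge_c (rt_b w)" "rt_b (wedge_d w) = wedge_d (rt_b w)"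
  "rt_c (wedge_a w) = wedge_a (rt_c w)" "rt_c (wedge_b w) = wedge_b (rt_c w)"
  "rt_c (wedge_c w) = wedge_c (rt_c w)" "rt_c (wedge_d w) = wedge_d (rt_c w)"
  "rt_d (wedge_a w) = wedge_a (rt_d w)" "rt_d (wedge_b w) = wedge_b (rt_d w)"
  "rt_d (wedge_c w) = wedge_c (rt_d w)" "rt_d (wedge_d w) = wedge_d (rt_d w)"
  by (rule tensor_eqI, rename_tac I m n k, case_tac I;
      simp add: rt_a_def rt_b_def rt_c_def rt_d_def algebra_simps)+

text \<open>Left and right multiplication commute; for the letters e this comes down to
  associativity of \<Lambda>.\<close>

lemma rtheta_wedge:
  "rtheta (wedge_a w) = wedge_a (rtheta w)" "rtheta (wedge_b w) = wedge_b (rtheta w)"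
  "rtheta (wedge_c w) = wedge_c (rtheta w)" "rtheta (wedge_d w) = wedge_d (rtheta w)"
  by (rule tensor_eqI, rename_tac I m n k, case_tac I; simp add: rt_comm qring)+

text \<open>The same compatibility for a, b, c. On the function w they act untwisted, but w \<theta>
  is a 1-form, so on the right-hand side they act through the coproduct.\<close>

lemma rtheta_left:
  assumes "supp forms1 w"
  shows "rtheta (left_a w) = gen_a (rtheta w)"
    and "rtheta (left_b w) = gen_b (rtheta w)"
    and "rtheta (left_c w) = gen_c (rtheta w)"
proof -
  have w: "w I m n k = 0" if "I \<noteq> F1" for I m n k
    using assms that by (auto simp: supp_def)
  note defs = rt_a_def rt_b_def rt_c_def rt_d_def gen_defs left_a_def left_b_def left_c_def left_d_def
  show "rtheta (left_a w) = gen_a (rtheta w)"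
    by (rule tensor_eqI, rename_tac I m n k, case_tac I; simp add: defs w; case_tac m; case_tac n; case_tac k;
      simp add: w qring)
  show "rtheta (left_b w) = gen_b (rtheta w)"
    by (rule tensor_eqI, rename_tac I m n k, case_tac I; simp add: defs w; case_tac m; case_tac n; case_tac k;
      simp add: w qring)
  show "rtheta (left_c w) = gen_c (rtheta w)"
    by (rule tensor_eqI, rename_tac I m n k, case_tac I; simp add: defs w; case_tac m; case_tac n; case_tac k;
      simp add: w qring)
qed

lemma act_sums: "act (x + y) w = act x w + act y w" "act (cst z * x) w = smul z (act x w)"
  by (simp_all add: act_simps)

lemma coords_theta: "coords theta = rtheta (unit T0 T0 T0)"
proof -
  have "coords theta = wedge_a (unit T0 T0 T0) + wedge_d (unit T0 T0 T0)"
    by (simp add: coords_def act_simps)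
  also have "\<dots> = rtheta (unit T0 T0 T0)"
    by (rule tensor_eqI, rename_tac I m n k, case_tac I; simp add: rt_a_def rt_b_def rt_c_def rt_d_def;
      case_tac m; case_tac n; case_tac k; simp add: unit_apply qring)
  finally show ?thesis .
qed

lemma act_monomial_rtheta: "act (monomial m n k) (rtheta (unit T0 T0 T0)) = rtheta (unit m n k)"
proof -
  note rules = gen_forms1[OF supp_unit] left_unit rtheta_left[OF supp_unit, symmetric]
  show ?thesis
    by (cases m; cases n; cases k; simp add: monomial_def act_simps rules)
qed

lemma act_iota_A_rtheta: "act (iota_A s) (rtheta (unit T0 T0 T0)) = rtheta (act (iota_A s) (unit T0 T0 T0))"
  by (simp add: iota_A_def act_sum act_sums act_monomial_rtheta act_monomial lin_rtheta[THEN lin_smul]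
      lin_sum[OF _ lin_rtheta])

lemma act_form_word_rtheta: "act (form_word I) (rtheta w) = rtheta (act (form_word I) w)"
  by (cases I) (simp_all add: act_simps rtheta_wedge)

text \<open>The letters of the normal form of x act one after the other and \<open>rtheta\<close>
  commutes with each of them. What remains is the value at 1, which is
  \<open>coords_theta\<close>.\<close>

lemma coords_mult_theta: "coords (x * theta) = rtheta (coords x)"
proof -
  have "coords (x * theta) = act (iota (coords x)) (rtheta (unit T0 T0 T0))"
    using coords_theta eqv_act[OF iota_coords[of x]] by (simp add: coords_def act_mult)
  also have "\<dots> = rtheta (act (iota (coords x)) (unit T0 T0 T0))"
    by (simp add: iota_def act_sum act_mult act_iota_A_rtheta act_form_word_rtheta lin_sum[OF _ lin_rtheta])
  also have "\<dots> = rtheta (coords x)"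
    using coords_iota[of "coords x"] by (simp add: coords_def)
  finally show ?thesis .
qed

definition ext_d_coords :: "nat \<Rightarrow> tensor \<Rightarrow> tensor" where
  "ext_d_coords i w = smul ((- 1) ^ i) (rtheta w) - wedge_a w - wedge_d w"

lemma ext_d_cls: "ext_d q i (cls q x) = form_of (ext_d_coords i (coords x))"
proof -
  have m1: "- 1 = cst (- 1)"
    using cst_minus_1[of 1] by simp
  have sign: "(- 1) ^ i = cst ((- 1) ^ i)" for i
    by (induction i) (simp_all only: power_0 power_Suc m1 cst_simps(2,4))
  have "ext_d q i (cls q x) = cls q (- (theta * x - (-1) ^ i * (x * theta)))"
    by (simp add: ext_d_def cls_simps)
  also have "\<dots> = form_of (ext_d_coords i (coords x))"
    unfolding form_of_coords[symmetric] form_of_eq_iff coords_simps sign coords_mult_theta distrib_right ext_d_coords_def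
    by (simp add: algebra_simps)
  finally show ?thesis .
qed

lemma ext_d_form_of: "ext_d q i (form_of w) = form_of (ext_d_coords i w)"
  unfolding form_of_def[of w] ext_d_cls coords_iota ..

section \<open>The Hodge operator\<close>

primrec star_word :: "form \<Rightarrow> free" where
  "star_word F1 = ea * eb * ec * ed"
| "star_word Fa = - (ea * eb * ec) - cst (mu q) * eb * ec * ed"
| "star_word Fb = - (ea * eb * ed)"
| "star_word Fc = cst (q ^ 2) * ea * ec * ed"
| "star_word Fd = eb * ec * ed"
| "star_word Fab = - (ea * eb) + cst (2 * mu q) * eb * ed"
| "star_word Fac = ea * ec"
| "star_word Fad = cst (1 / (1 + q ^ 2)) * (cst 2 * eb * ec - cst (q ^ 2 * mu q) * ea * ed)"
| "star_word Fbc = cst (q ^ 2 / (1 + q ^ 2)) * (cst 2 * ea * ed + cst (mu q) * eb * ec)"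
| "star_word Fbd = eb * ed"
| "star_word Fcd = - (ec * ed)"
| "star_word Fabc = - ea - cst (mu q) * ed"
| "star_word Fabd = - eb"
| "star_word Facd = cst (inverse (q ^ 2)) * ec"
| "star_word Fbcd = ed"
| "star_word Fabcd = 1"

lemma hodge_table_eq: "hodge_table q = range (\<lambda>I. (form_word I, star_word I))"
proof -
  have 1: "UNIV = {F1, Fabcd, Fa, Fb, Fc, Fd, Fab, Fac, Fad, Fbc, Fbd, Fcd, Fabc, Fabd, Facd, Fbcd}"
    by (simp add: UNIV_form insert_commute)
  show ?thesis
    by (simp only: 1 hodge_table_def image_insert image_empty form_word.simps star_word.simps mult.assoc)
qed

lemma inverse_1_q2: "1 / (1 + q ^ 2) = 1 + q" "q ^ 2 / (1 + q ^ 2) = - q"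
proof -
  have 1: "1 + q ^ 2 = - q"
    by (simp add: q2)
  have "inverse (- q) = 1 + q"
    by (rule inverse_unique) (simp add: qring)
  then show "1 / (1 + q ^ 2) = 1 + q" "q ^ 2 / (1 + q ^ 2) = - q"
    unfolding 1 using q_nz by (simp_all add: divide_inverse power2_eq_square qring)
qed

lemma act_star_word: "act (star_word I) (embed s) = star (\<lambda>J. if J = I then s else (\<lambda>m n k. 0))"
  by (cases I; simp only: star_word.simps inverse_1_q2 inverse_q2 mu;
    rule tensor_eqI, rename_tac J m n k, case_tac J; simp add: act_simps embed_def q2 qring)

text \<open>Right multiplication by a function acts on the coefficients, independently of the form.\<close>

definition right_coord :: "free \<Rightarrow> coord \<Rightarrow> coord" where
  "right_coord u s = coords (iota_A s * u) F1"

lemma right_coord: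
  assumes "homogeneous 0 u"
  shows "coords (iota_A s * u) = embed (right_coord u s)"
proof -
  have "has_deg 0 (coords (iota_A s * u))"
    using assms by (intro has_deg_coords homogeneous_mult_0 homogeneous_iota_A)
  then show ?thesis
    by (auto simp: has_deg_iff all_form right_coord_def embed_def fun_eq_iff)
qed

lemma sum_star: "(\<Sum>I\<in>UNIV. star (\<lambda>J. if J = I then w I else (\<lambda>m n k. 0))) = star w"
  by (rule tensor_eqI, rename_tac I m n k, case_tac I; simp add: sum_form)

lemma sum_forms: "(\<Sum>I\<in>UNIV. (\<lambda>J. if J = I then w I else (\<lambda>m n k. 0))) = (w :: tensor)"
  by (rule tensor_eqI, rename_tac I m n k, case_tac I; simp add: sum_form)

text \<open>Because (e_I f) u = e_I (f u), one and the same linear map acts on every coefficient. It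
  therefore commutes with \<open>star\<close>, which combines coefficients with constant
  scalars.\<close>

lemma coords_mult_right:
  assumes "homogeneous 0 u"
  shows "coords (x * u) = (\<lambda>I. right_coord u (coords x I))"
proof -
  have "coords (x * u) = act (iota (coords x)) (coords u)"
    using eqv_act[OF iota_coords[of x]] by (simp add: coords_def act_mult)
  also have "\<dots> = (\<Sum>I\<in>UNIV. act (form_word I) (embed (right_coord u (coords x I))))"
    by (simp add: iota_def act_sum act_mult coords_def flip: right_coord[OF assms])
  also have "\<dots> = (\<lambda>I. right_coord u (coords x I))"
    by (simp add: act_form_word sum_forms)
  finally show ?thesis .
qed

lemma right_coord_lin:
  "right_coord u (\<lambda>m n k. s m n k + t m n k) = (\<lambda>m n k. right_coord u s m n k + right_coord u t m n k)"
  "right_coord u (\<lambda>m n k. z * s m n k) = (\<lambda>m n k. z * right_coord u s m n k)"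
  by (simp_all add: right_coord_def iota_A_add iota_A_smul distrib_right mult.assoc coords_simps fun_eq_iff)

lemma right_coord_lin':
  "right_coord u (\<lambda>m n k. - s m n k) = (\<lambda>m n k. - right_coord u s m n k)"
  "right_coord u (\<lambda>m n k. s m n k - t m n k) = (\<lambda>m n k. right_coord u s m n k - right_coord u t m n k)"
  using right_coord_lin(2)[of u "- 1"] right_coord_lin(1)[of u s "\<lambda>m n k. - t m n k"] by simp_all

lemma star_right_coord: "star (\<lambda>I. right_coord u (w I)) = (\<lambda>I. right_coord u (star w I))"
  by (rule tensor_eqI, rename_tac I m n k, case_tac I) (simp_all add: right_coord_lin right_coord_lin')

definition is_hodge :: "(free set \<Rightarrow> free set) \<Rightarrow> bool" where
  "is_hodge f \<longleftrightarrow> f \<in> carrier (Omega q) \<rightarrow>\<^sub>E carrier (Omega q) \<and>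
     (\<forall>x \<in> carrier (Omega q). \<forall>y \<in> carrier (Omega q).
        f (x \<oplus>\<^bsub>Omega q\<^esub> y) = f x \<oplus>\<^bsub>Omega q\<^esub> f y) \<and>
     (\<forall>x \<in> carrier (Omega q). \<forall>u \<in> calA q.
        f (x \<otimes>\<^bsub>Omega q\<^esub> u) = f x \<otimes>\<^bsub>Omega q\<^esub> u) \<and>
     (\<forall>(x, y) \<in> hodge_table q. f (cls q x) = cls q y)"

lemma calA_cls: "homogeneous 0 u \<Longrightarrow> cls q u \<in> calA q"
  by (auto simp: Omega_deg_def homogeneous_def)

text \<open>A normal form is a sum of terms e_I f with f in A, so additivity, right linearity and
  the table fix the value. Complex linearity is part of right linearity, since A contains the
  scalars.\<close>

lemma is_hodge_unique:
  assumes "is_hodge f"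
  shows "f (cls q x) = form_of (star (coords x))"
proof -
  have add: "f (cls q (y + z)) = f (cls q y) \<oplus>\<^bsub>Omega q\<^esub> f (cls q z)" for y z
    using assms by (simp add: is_hodge_def flip: cls_add)
  have basis: "f (cls q (form_word I * iota_A s)) = cls q (star_word I * iota_A s)" for I s
    using assms calA_cls[OF homogeneous_iota_A, of s]
    by (simp add: is_hodge_def hodge_table_eq flip: cls_mult)
  have coords_sum: "coords (\<Sum>i\<in>S. y i) = (\<Sum>i\<in>S. coords (y i))" for S :: "form set" and y
    by (simp only: coords_def act_sum)
  have term_coords: "coords (star_word I * iota_A s) = star (\<lambda>J. if J = I then s else (\<lambda>m n k. 0))" for I s
    using coords_iota_A[of s] by (simp only: coords_def act_mult act_star_word)
  have "f (cls q x) = f (cls q (iota (coords x)))"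
    using iota_coords[of x] by (metis cls_eq_iff)
  also have "\<dots> = cls q (\<Sum>I\<in>UNIV. star_word I * iota_A (coords x I))"
    by (simp only: iota_def sum_form add basis cls_add)
  also have "\<dots> = form_of (star (coords x))"
    unfolding form_of_coords[symmetric] form_of_eq_iff
    by (simp only: coords_sum term_coords sum_star)
  finally show ?thesis .
qed

lemma is_hodge_exists: "is_hodge (\<lambda>X \<in> carrier (Omega q). form_of (star (coords (SOME x. X = cls q x))))"
  (is "is_hodge ?H")
proof -
  \<comment> \<open>The chosen representative does not matter, as coordinates depend only on the
    class.\<close>
  have H: "?H (cls q x) = form_of (star (coords x))" for x
  proof -
    have "cls q x = cls q (SOME y. cls q x = cls q y)"
      by (rule someI) simp
    then show ?thesis
      by (simp add: cls_coords)
  qed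
  have form: "form_of w \<in> carrier (Omega q)" for w
    by (simp add: form_of_def)
  show ?thesis
    unfolding is_hodge_def
  proof (intro conjI ballI)
    show "?H \<in> carrier (Omega q) \<rightarrow>\<^sub>E carrier (Omega q)"
      using form by auto
  next
    fix X Y assume "X \<in> carrier (Omega q)" "Y \<in> carrier (Omega q)"
    then obtain x y where "X = cls q x" "Y = cls q y"
      by (auto simp: carrier_Omega)
    then show "?H (X \<oplus>\<^bsub>Omega q\<^esub> Y) = ?H X \<oplus>\<^bsub>Omega q\<^esub> ?H Y"
      by (simp only: H cls_add coords_simps lin_simps form_of_add)
  next
    fix X U assume "X \<in> carrier (Omega q)" "U \<in> calA q"
    then obtain x u where X: "X = cls q x" "U = cls q u" and u: "homogeneous 0 u"
      by (auto simp: carrier_Omega Omega_deg_def homogeneous_def)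
    have "form_of (star (coords (x * u))) = form_of (star (coords x)) \<otimes>\<^bsub>Omega q\<^esub> cls q u"
      by (simp add: form_of_def cls_mult cls_coords coords_iota coords_mult_right[OF u] star_right_coord)
    then show "?H (X \<otimes>\<^bsub>Omega q\<^esub> U) = ?H X \<otimes>\<^bsub>Omega q\<^esub> U"
      by (simp only: X H cls_mult)
  next
    \<comment> \<open>The entries of the table are the case in which the coefficient is the function
      1.\<close>
    have unit: "embed (unit T0 T0 T0 F1) = unit T0 T0 T0"
      by (rule tensor_eqI) (simp add: embed_def unit_apply)
    have star: "coords (star_word I) = star (coords (form_word I))" for I
      using act_star_word[of I "unit T0 T0 T0 F1"] act_form_word[of I "unit T0 T0 T0 F1"]
      by (simp only: coords_def unit)
    fix p assume "p \<in> hodge_table q"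
    then obtain I where "p = (form_word I, star_word I)"
      by (auto simp: hodge_table_eq)
    then show "case p of (x, y) \<Rightarrow> ?H (cls q x) = cls q y"
      by (simp only: prod.case H star [symmetric] form_of_coords)
  qed
qed

lemma hodge_form_of: "hodge q (form_of w) = form_of (star w)"
proof -
  have "\<exists>!f. is_hodge f"
  proof (rule ex1I[where P = is_hodge, OF is_hodge_exists])
    fix f assume f: "is_hodge f"
    show "f = (\<lambda>X \<in> carrier (Omega q). form_of (star (coords (SOME x. X = cls q x))))" (is "f = ?H")
    proof (rule PiE_ext)
      show "f \<in> carrier (Omega q) \<rightarrow>\<^sub>E carrier (Omega q)" "?H \<in> carrier (Omega q) \<rightarrow>\<^sub>E carrier (Omega q)"
        using f[unfolded is_hodge_def, THEN conjunct1] is_hodge_exists[unfolded is_hodge_def, THEN conjunct1]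
        by this
      show "f X = ?H X" if "X \<in> carrier (Omega q)" for X
        using that is_hodge_unique[OF f] is_hodge_unique[OF is_hodge_exists] by (auto simp only: carrier_Omega)
    qed
  qed
  then have "is_hodge (hodge q)"
    unfolding hodge_def is_hodge_def by (rule theI')
  then show ?thesis
    by (simp add: is_hodge_unique form_of_def[of w] coords_iota)
qed

definition codiff_coords :: "nat \<Rightarrow> tensor \<Rightarrow> tensor" where
  "codiff_coords i w = star (ext_d_coords (4 - i) (star w))"

definition Maxwell_coords :: "tensor \<Rightarrow> tensor" where
  "Maxwell_coords w = codiff_coords 2 (ext_d_coords 1 w)"

lemma codiff_form_of: "codiff q i (form_of w) = form_of (codiff_coords i w)"
  by (simp add: codiff_def hodge_form_of ext_d_form_of codiff_coords_def)

lemma Maxwell_form_of: "Maxwell q (form_of w) = form_of (Maxwell_coords w)"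
  by (simp add: Maxwell_def codiff_form_of ext_d_form_of Maxwell_coords_def)

end

section \<open>The Maxwell operator in coordinates\<close>

context cube_root
begin

lemma lin_ext_d_coords: "lin (ext_d_coords i)"
  by (rule linI; rule tensor_eqI; simp add: ext_d_coords_def lin_simps algebra_simps)

lemma lin_codiff_coords: "lin (codiff_coords i)"
  by (rule linI) (simp_all add: codiff_coords_def lin_simps lin_ext_d_coords[THEN lin_add] lin_ext_d_coords[THEN lin_smul])

lemma lin_Maxwell_coords: "lin Maxwell_coords"
  by (rule linI) (simp_all only: Maxwell_coords_def lin_ext_d_coords[THEN lin_add] lin_ext_d_coords[THEN lin_smul]
      lin_codiff_coords[THEN lin_add] lin_codiff_coords[THEN lin_smul])

lemmas eval_defs = codiff_coords_def ext_d_coords_def rt_a_def rt_b_def rt_c_def rt_d_def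

text \<open>Each line is a linear dependence among the rows of the matrix of
  \<open>codiff_coords 2\<close>. For \<theta> f the entries at e_b and e_c vanish and those at e_a
  and e_d agree, which turns each line into an equation in at most two coordinates of f.\<close>

lemma codiff_coords_functionals:
  "(- 1 - q) * codiff_coords 2 v Fa T0 T2 T2 + codiff_coords 2 v Fb T1 T2 T1 = 0"
  "(2 + q) * codiff_coords 2 v Fa T1 T0 T1 + (- 1 - 2 * q) * codiff_coords 2 v Fa T1 T1 T2
     + (- 1 - q) * codiff_coords 2 v Fb T2 T0 T0 + (- 1) * codiff_coords 2 v Fb T2 T1 T1
     + codiff_coords 2 v Fc T0 T0 T2 = 0"
  "(- 2 - q) * codiff_coords 2 v Fa T2 T2 T1 + (- 1) * codiff_coords 2 v Fb T0 T2 T0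
     + codiff_coords 2 v Fc T1 T1 T1 = 0"
  "(2 + q) * codiff_coords 2 v Fa T0 T1 T1 + (q) * codiff_coords 2 v Fb T1 T1 T0 + codiff_coords 2 v Fc T2 T0 T1 = 0"
  "(- 1) * codiff_coords 2 v Fa T0 T0 T1 + (2 + q) * codiff_coords 2 v Fa T0 T1 T2
     + (- q) * codiff_coords 2 v Fb T1 T0 T0 + (- 1) * codiff_coords 2 v Fb T1 T1 T1
     + codiff_coords 2 v Fc T2 T0 T2 + codiff_coords 2 v Fd T0 T0 T1 = 0"
  "(2 * q) * codiff_coords 2 v Fa T0 T0 T2 + (- 1 - q) * codiff_coords 2 v Fb T1 T0 T1
     + (q) * codiff_coords 2 v Fb T1 T1 T2 + codiff_coords 2 v Fd T0 T0 T2 = 0"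
  "(- 1) * codiff_coords 2 v Fa T0 T1 T0 + (1 + 2 * q) * codiff_coords 2 v Fa T0 T2 T1
     + (- 1) * codiff_coords 2 v Fb T1 T2 T0 + codiff_coords 2 v Fc T2 T1 T1
     + codiff_coords 2 v Fd T0 T1 T0 = 0"
  "(1 + q) * codiff_coords 2 v Fa T0 T2 T0 + (1 + q) * codiff_coords 2 v Fc T2 T2 T1
     + codiff_coords 2 v Fd T0 T2 T0 = 0"
  "(- 1) * codiff_coords 2 v Fa T1 T0 T0 + (- 1 + q) * codiff_coords 2 v Fa T1 T1 T1
     + codiff_coords 2 v Fb T2 T1 T0 + (- 1 - q) * codiff_coords 2 v Fc T0 T0 T1
     + codiff_coords 2 v Fd T1 T0 T0 = 0"
  "(1 + q) * codiff_coords 2 v Fa T1 T1 T0 + (- 1 - 2 * q) * codiff_coords 2 v Fa T1 T2 T1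
     + (q) * codiff_coords 2 v Fb T2 T2 T0 + (- q) * codiff_coords 2 v Fc T0 T1 T1
     + codiff_coords 2 v Fd T1 T1 T0 = 0"
  "(2 * q) * codiff_coords 2 v Fa T1 T2 T2 + codiff_coords 2 v Fb T2 T2 T1 + codiff_coords 2 v Fd T1 T2 T2 = 0"
  "(1 + q) * codiff_coords 2 v Fa T2 T0 T0 + (1 - q) * codiff_coords 2 v Fa T2 T1 T1
     + (- q) * codiff_coords 2 v Fb T0 T1 T0 + (- 1) * codiff_coords 2 v Fc T1 T0 T1
     + codiff_coords 2 v Fd T2 T0 T0 = 0"
  "(2 * q) * codiff_coords 2 v Fa T2 T1 T2 + (q) * codiff_coords 2 v Fb T0 T1 T1
     + (- q) * codiff_coords 2 v Fb T0 T2 T2 + codiff_coords 2 v Fd T2 T1 T2 = 0"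
  "(- 1) * codiff_coords 2 v Fa T2 T1 T1 + (1 - q) * codiff_coords 2 v Fa T2 T2 T2
     + (- 1) * codiff_coords 2 v Fb T0 T1 T0 + codiff_coords 2 v Fb T0 T2 T1
     + (q) * codiff_coords 2 v Fc T1 T1 T2 + codiff_coords 2 v Fd T2 T1 T1 = 0"
  by (simp add: eval_defs qring)+

lemma Maxwell_coords_functionals:
  "Maxwell_coords w Fa T1 T0 T2 = 0"
  "Maxwell_coords w Fa T2 T2 T0 = 0"
  "Maxwell_coords w Fa T2 T0 T2 + Maxwell_coords w Fb T0 T0 T1 = 0"
  "(- q) * Maxwell_coords w Fa T1 T2 T0 + Maxwell_coords w Fc T0 T1 T0 = 0"
  "(q) * Maxwell_coords w Fa T2 T1 T0 + (- q) * Maxwell_coords w Fa T2 T2 T1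
     + (- 1 - q) * Maxwell_coords w Fb T0 T2 T0 + Maxwell_coords w Fc T1 T0 T0 = 0"
  "(- q) * Maxwell_coords w Fa T2 T0 T1 + (- 1 - q) * Maxwell_coords w Fa T2 T1 T2 + Maxwell_coords w Fb T0 T2 T2 = 0"
  "(q) * Maxwell_coords w Fa T1 T1 T2 + Maxwell_coords w Fb T2 T1 T1 = 0"
  "(q) * Maxwell_coords w Fa T1 T2 T1 + Maxwell_coords w Fb T2 T2 T0 = 0"
  by (simp add: Maxwell_coords_def eval_defs qring)+

section \<open>Evaluation on sparse tensors\<close>

lemma rt_unit:
  "rt_a (unit m n k) = smul (wt m * wt n * wt' k) (unit m n k)"
  "rt_b (unit m n k) = smul ((1 - q) * wt n * br k) (unit (succ3 m) n (pred3 k))"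
  "rt_c (unit m n k) = smul ((1 - q) * br n * wt' k) (unit (pred3 m) (pred3 n) k)
     + (if k = T2 then 0 else smul ((- 2 - q) * wt' k * (br n + br m * wt m * wt n)) (unit (pred3 m) n (succ3 k)))"
  "rt_d (unit m n k) = smul (rt_coeff (add3 m n) k) (unit m n k)
     + smul ((3 + 3 * q) * wt' m * br n * br k) (unit m (pred3 n) (pred3 k))"
  by (cases m; cases n; cases k; rule tensor_eqI, rename_tac I m' n' k', case_tac m'; case_tac n'; case_tac k';
    simp add: unit_apply rt_a_def rt_b_def rt_c_def rt_d_def)+

text \<open>Images of basis vectors stay sums of wedges of basis vectors. The derivative and
  codifferential of an explicit field are then short symbolic sums, without a case split over all
  432 coordinates.\<close>

lemma rtheta_unit: "rtheta (unit m n k) = wedge_a (rt_a (unit m n k)) + wedge_b (rt_b (unit m n k))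
    + wedge_c (rt_c (unit m n k)) + wedge_d (rt_d (unit m n k))"
  by (rule tensor_eqI, rename_tac I m' n' k', case_tac I) (simp_all add: rt_a_def rt_b_def rt_c_def rt_d_def unit_apply)

lemma star_wedge_unit:
  "star (wedge_a (unit m n k)) = - wedge_a (wedge_b (wedge_c (unit m n k)))
     - smul (1 - q) (wedge_b (wedge_c (wedge_d (unit m n k))))"
  "star (wedge_b (unit m n k)) = - wedge_a (wedge_b (wedge_d (unit m n k)))"
  "star (wedge_c (unit m n k)) = smul (- 1 - q) (wedge_a (wedge_c (wedge_d (unit m n k))))"
  "star (wedge_d (unit m n k)) = wedge_b (wedge_c (wedge_d (unit m n k)))"
  "star (wedge_a (wedge_b (unit m n k))) = - wedge_a (wedge_b (unit m n k))
     + smul (2 - 2 * q) (wedge_b (wedge_d (unit m n k)))"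
  "star (wedge_a (wedge_c (unit m n k))) = wedge_a (wedge_c (unit m n k))"
  "star (wedge_a (wedge_d (unit m n k))) = smul (2 + 2 * q) (wedge_b (wedge_c (unit m n k)))
     + smul (1 + 2 * q) (wedge_a (wedge_d (unit m n k)))"
  "star (wedge_b (wedge_c (unit m n k))) = smul (- 2 * q) (wedge_a (wedge_d (unit m n k)))
     + smul (- 1 - 2 * q) (wedge_b (wedge_c (unit m n k)))"
  "star (wedge_b (wedge_d (unit m n k))) = wedge_b (wedge_d (unit m n k))"
  "star (wedge_c (wedge_d (unit m n k))) = - wedge_c (wedge_d (unit m n k))"
  "star (wedge_a (wedge_b (wedge_c (unit m n k)))) = - wedge_a (unit m n k) - smul (1 - q) (wedge_d (unit m n k))"
  "star (wedge_a (wedge_b (wedge_d (unit m n k)))) = - wedge_b (unit m n k)"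
  "star (wedge_a (wedge_c (wedge_d (unit m n k)))) = smul q (wedge_c (unit m n k))"
  "star (wedge_b (wedge_c (wedge_d (unit m n k)))) = wedge_d (unit m n k)"
  "star (wedge_a (wedge_b (wedge_c (wedge_d (unit m n k))))) = unit m n k"
  by (rule tensor_eqI, rename_tac I m' n' k', case_tac I; simp add: unit_apply qring)+

text \<open>Tensors also carry a pointwise product, so equal summands may be collected into a
  numeral times a tensor; this restores a scalar multiple.\<close>

lemma numeral_smul: "numeral l * w = smul (numeral l) w"
  by (rule tensor_eqI) simp

lemmas ext_d_unit_simps = numeral_smul lin_simps smul_add smul_smul rtheta_wedge rtheta_unit rt_unit wedge_rels wedge_rels' star_wedge_unit

text \<open>Gauge fields for \<open>12 \<theta>\<close>, \<open>12 \<theta> a\<close>, \<open>12 \<theta> b\<close>, \<open>12 \<theta> c\<close>, \<open>12 \<theta> d\<close> and their curvatures, found by solving the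
  linear system; the factor 12 clears denominators.\<close>

definition field_1 :: tensor where
  "field_1 = smul (-1 - 2*q) (wedge_a (unit T0 T0 T0))
     + smul (1 + q) (wedge_a (unit T0 T1 T1))
     + smul (1 + q) (wedge_a (unit T0 T2 T2))
     + smul (-1 - 2*q) (wedge_c (unit T2 T0 T1))
     + smul (1 + q) (wedge_d (unit T0 T1 T1))
     + smul (1 + q) (wedge_d (unit T0 T2 T2))"

definition curv_1 :: tensor where
  "curv_1 = smul (1 - q) (wedge_a (wedge_b (unit T1 T1 T0)))
     + smul (-1 - 2*q) (wedge_a (wedge_b (unit T1 T2 T1)))
     + smul (1 + 2*q) (wedge_a (wedge_c (unit T2 T0 T1)))
     + smul (-3*q) (wedge_a (wedge_d (unit T0 T0 T0)))
     + smul (-1 + q) (wedge_b (wedge_d (unit T1 T1 T0)))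
     + smul (1 + 2*q) (wedge_b (wedge_d (unit T1 T2 T1)))
     + smul (-1 - 2*q) (wedge_c (wedge_d (unit T2 T0 T1)))"

lemma curv_1: "ext_d_coords 1 field_1 = curv_1"
  unfolding field_1_def curv_1_def ext_d_coords_def
  by (simp add: ext_d_unit_simps, rule tensor_eqI, simp add: qring)

lemma source_1: "codiff_coords 2 curv_1 = smul (12) (wedge_a (unit T0 T0 T0))
     + smul (12) (wedge_d (unit T0 T0 T0))"
  unfolding curv_1_def codiff_coords_def ext_d_coords_def
  by (simp add: ext_d_unit_simps, rule tensor_eqI, simp add: qring)

definition field_a :: tensor where
  "field_a = smul (-2*q) (wedge_a (unit T1 T1 T1))
     + smul (-4 - 4*q) (wedge_b (unit T2 T1 T0))
     + smul (-2 - 2*q) (wedge_c (unit T0 T1 T2))"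

definition curv_a :: tensor where
  "curv_a = smul (4 + 2*q) (wedge_a (wedge_b (unit T2 T1 T0)))
     + smul (2 - 2*q) (wedge_a (wedge_c (unit T0 T0 T1)))
     + smul (2 + 4*q) (wedge_a (wedge_c (unit T0 T1 T2)))
     + smul (6 + 6*q) (wedge_a (wedge_d (unit T1 T0 T0)))
     + smul (-4 - 2*q) (wedge_a (wedge_d (unit T1 T1 T1)))
     + smul (8 + 4*q) (wedge_b (wedge_c (unit T1 T0 T0)))
     + smul (-6) (wedge_b (wedge_c (unit T1 T1 T1)))
     + smul (-4 + 4*q) (wedge_b (wedge_d (unit T2 T1 T0)))
     + smul (-6*q) (wedge_c (wedge_d (unit T0 T0 T1)))
     + smul (-2 + 2*q) (wedge_c (wedge_d (unit T0 T1 T2)))"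

lemma curv_a: "ext_d_coords 1 field_a = curv_a"
  unfolding field_a_def curv_a_def ext_d_coords_def
  by (simp add: ext_d_unit_simps, rule tensor_eqI, simp add: qring)

lemma source_a: "codiff_coords 2 curv_a = smul (12) (wedge_a (unit T1 T0 T0))
     + smul (12) (wedge_d (unit T1 T0 T0))"
  unfolding curv_a_def codiff_coords_def ext_d_coords_def
  by (simp add: ext_d_unit_simps, rule tensor_eqI, simp add: qring)

definition field_b :: tensor where
  "field_b = smul (2) (wedge_a (unit T0 T2 T1))
     + smul (4 + 4*q) (wedge_b (unit T1 T2 T0))
     + smul (-2 - 2*q) (wedge_c (unit T2 T0 T0))
     + smul (-2) (wedge_c (unit T2 T2 T2))"

definition curv_b :: tensor where
  "curv_b = smul (-4 - 2*q) (wedge_a (wedge_b (unit T1 T2 T0)))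
     + smul (4 + 2*q) (wedge_a (wedge_c (unit T2 T0 T0)))
     + smul (-4 - 2*q) (wedge_a (wedge_c (unit T2 T1 T1)))
     + smul (4 + 2*q) (wedge_a (wedge_c (unit T2 T2 T2)))
     + smul (6 + 6*q) (wedge_a (wedge_d (unit T0 T1 T0)))
     + smul (-2 - 4*q) (wedge_a (wedge_d (unit T0 T2 T1)))
     + smul (8 + 4*q) (wedge_b (wedge_c (unit T0 T1 T0)))
     + smul (-6 - 6*q) (wedge_b (wedge_c (unit T0 T2 T1)))
     + smul (4 - 4*q) (wedge_b (wedge_d (unit T1 T2 T0)))
     + smul (-2 - 4*q) (wedge_c (wedge_d (unit T2 T0 T0)))
     + smul (-6) (wedge_c (wedge_d (unit T2 T1 T1)))
     + smul (2 + 4*q) (wedge_c (wedge_d (unit T2 T2 T2)))"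

lemma curv_b: "ext_d_coords 1 field_b = curv_b"
  unfolding field_b_def curv_b_def ext_d_coords_def
  by (simp add: ext_d_unit_simps, rule tensor_eqI, simp add: qring)

lemma source_b: "codiff_coords 2 curv_b = smul (12) (wedge_a (unit T0 T1 T0))
     + smul (12) (wedge_d (unit T0 T1 T0))"
  unfolding curv_b_def codiff_coords_def ext_d_coords_def
  by (simp add: ext_d_unit_simps, rule tensor_eqI, simp add: qring)

definition field_c :: tensor where
  "field_c = smul (2) (wedge_a (unit T0 T1 T2))
     + smul (4 + 4*q) (wedge_b (unit T1 T1 T1))
     + smul (-2*q) (wedge_c (unit T2 T0 T2))"

definition curv_c :: tensor where
  "curv_c = smul (-2 - 4*q) (wedge_a (wedge_b (unit T1 T1 T1)))
     + smul (-4 - 2*q) (wedge_a (wedge_c (unit T2 T0 T2)))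
     + smul (6 + 6*q) (wedge_a (wedge_d (unit T0 T0 T1)))
     + smul (2 - 2*q) (wedge_a (wedge_d (unit T0 T1 T2)))
     + smul (6 + 12*q) (wedge_b (wedge_c (unit T0 T0 T1)))
     + smul (-6*q) (wedge_b (wedge_c (unit T0 T1 T2)))
     + smul (-12) (wedge_b (wedge_d (unit T1 T0 T0)))
     + smul (8 + 4*q) (wedge_b (wedge_d (unit T1 T1 T1)))
     + smul (-2 - 4*q) (wedge_c (wedge_d (unit T2 T0 T2)))"

lemma curv_c: "ext_d_coords 1 field_c = curv_c"
  unfolding field_c_def curv_c_def ext_d_coords_def
  by (simp add: ext_d_unit_simps, rule tensor_eqI, simp add: qring)

lemma source_c: "codiff_coords 2 curv_c = smul (12) (wedge_a (unit T0 T0 T1))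
     + smul (12) (wedge_d (unit T0 T0 T1))"
  unfolding curv_c_def codiff_coords_def ext_d_coords_def
  by (simp add: ext_d_unit_simps, rule tensor_eqI, simp add: qring)

definition field_d :: tensor where
  "field_d = smul (2) (wedge_a (unit T2 T0 T0))
     + smul (-2*q) (wedge_a (unit T2 T2 T2))
     + smul (4*q) (wedge_b (unit T0 T2 T1))
     + smul (2*q) (wedge_c (unit T1 T0 T1))
     + smul (2 + 2*q) (wedge_c (unit T1 T1 T2))"

definition curv_d :: tensor where
  "curv_d = smul (2 - 2*q) (wedge_a (wedge_b (unit T0 T2 T1)))
     + smul (4 + 2*q) (wedge_a (wedge_c (unit T1 T0 T1)))
     + smul (2 - 2*q) (wedge_a (wedge_c (unit T1 T1 T2)))
     + smul (8 + 4*q) (wedge_a (wedge_d (unit T2 T0 T0)))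
     + smul (-6*q) (wedge_a (wedge_d (unit T2 T1 T1)))
     + smul (-2 - 4*q) (wedge_a (wedge_d (unit T2 T2 T2)))
     + smul (6 + 6*q) (wedge_b (wedge_c (unit T2 T0 T0)))
     + smul (6 - 6*q) (wedge_b (wedge_c (unit T2 T1 T1)))
     + smul (-6 - 6*q) (wedge_b (wedge_c (unit T2 T2 T2)))
     + smul (-12) (wedge_b (wedge_d (unit T0 T1 T0)))
     + smul (4 + 8*q) (wedge_b (wedge_d (unit T0 T2 T1)))
     + smul (2 + 4*q) (wedge_c (wedge_d (unit T1 T0 T1)))
     + smul (4 + 2*q) (wedge_c (wedge_d (unit T1 T1 T2)))"

lemma curv_d: "ext_d_coords 1 field_d = curv_d"
  unfolding field_d_def curv_d_def ext_d_coords_def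
  by (simp add: ext_d_unit_simps, rule tensor_eqI, simp add: qring)

lemma source_d: "codiff_coords 2 curv_d = smul (12) (wedge_a (unit T2 T0 T0))
     + smul (-12 - 12*q) (wedge_a (unit T2 T1 T1))
     + smul (12) (wedge_d (unit T2 T0 T0))
     + smul (-12 - 12*q) (wedge_d (unit T2 T1 T1))"
  unfolding curv_d_def codiff_coords_def ext_d_coords_def
  by (simp add: ext_d_unit_simps, rule tensor_eqI, simp add: qring)

section \<open>The sources \<theta> f in coordinates\<close>

lemma left_b_unit: "left_b (unit m n k) = (if n = T2 then 0 else smul (wt m) (unit m (succ3 n) k))"
  by (cases n; rule tensor_eqI, rename_tac I m' n' k', case_tac n'; simp add: left_b_def unit_apply)

lemma left_c_unit: "left_c (unit m n k) = (if k = T2 then 0 else smul (wt m) (unit m n (succ3 k)))"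
  by (cases k; rule tensor_eqI, rename_tac I m' n' k', case_tac k'; simp add: left_c_def unit_apply)

lemmas act_unit = coords_def act_simps lin_gen[THEN lin_add] lin_gen[THEN lin_smul] lin_gen[THEN lin_uminus]
  lin_gen[THEN lin_diff] lin_gen[THEN lin_zero] lin_simps smul_add smul_smul gen_forms1[OF supp_unit]
  left_d_def left_unit(1) left_b_unit left_c_unit

definition theta_mult :: "tensor \<Rightarrow> tensor" where
  "theta_mult w = wedge_a w + wedge_d w"

lemma coords_theta_mult: "coords (theta * x) = theta_mult (coords x)"
  by (simp add: coords_def act_simps theta_mult_def)

lemma lin_theta_mult: "lin theta_mult"
  by (rule linI) (simp_all add: theta_mult_def lin_simps smul_add)

lemma coords_gens: "coords 1 = unit T0 T0 T0" "coords ga = unit T1 T0 T0" "coords gb = unit T0 T1 T0"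
  "coords gc = unit T0 T0 T1" "coords gd = unit T2 T0 T0 + smul (- 1 - q) (unit T2 T1 T1)"
  by (simp_all add: act_unit)

lemma Maxwell_coords_field:
  "Maxwell_coords (smul (1 / 12) field_1) = theta_mult (coords 1)"
  "Maxwell_coords (smul (1 / 12) field_a) = theta_mult (coords ga)"
  "Maxwell_coords (smul (1 / 12) field_b) = theta_mult (coords gb)"
  "Maxwell_coords (smul (1 / 12) field_c) = theta_mult (coords gc)"
  "Maxwell_coords (smul (1 / 12) field_d) = theta_mult (coords gd)"
  unfolding Maxwell_coords_def lin_ext_d_coords[THEN lin_smul] lin_codiff_coords[THEN lin_smul] curv_1 curv_a curv_b curv_c curv_d
    source_1 source_a source_b source_c source_d coords_gens theta_mult_def
  by (simp_all add: lin_simps smul_add smul_smul diff_divide_distrib)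

lemma has_deg_field: "has_deg 1 field_1" "has_deg 1 field_a" "has_deg 1 field_b" "has_deg 1 field_c" "has_deg 1 field_d"
  unfolding field_1_def field_a_def field_b_def field_c_def field_d_def
  by (simp_all add: has_deg_iff all_form fun_eq_iff unit_apply)

lemma has_deg_linear: "has_deg i v \<Longrightarrow> has_deg i w \<Longrightarrow> has_deg i (v + w)"
  "has_deg i w \<Longrightarrow> has_deg i (smul z w)"
  unfolding has_deg_def by (rule supp_linear; assumption)+

text \<open>Each of these numbers divides 1 or 3 in Z[q]. They are the factors to be cancelled in
  the equations for the sources.\<close>

lemma nonzero: "- 1 - q \<noteq> 0" "2 + q \<noteq> 0" "1 + 2 * q \<noteq> 0" "1 - q \<noteq> 0" "- 2 - q \<noteq> 0"
proof -
  have "(- 1 - q) * q = 1" "(2 + q) * (1 - q) = 3" "(1 + 2 * q) * (- 1 - 2 * q) = 3" "(1 - q) * (2 + q) = 3"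
    "(- 2 - q) * (q - 1) = 3"
    by (simp_all add: qring)
  then show "- 1 - q \<noteq> 0" "2 + q \<noteq> 0" "1 + 2 * q \<noteq> 0" "1 - q \<noteq> 0" "- 2 - q \<noteq> 0"
    by (metis mult_zero_left zero_neq_one zero_neq_numeral)+
qed

text \<open>The 22 equations leave 27 - 22 = 5 free coordinates of f, those at 1, a, b, c and a^2.
  The one at a^2 fixes the one at a^2 bc, and all others vanish.\<close>

lemma valid_source_coeffs:
  assumes "Maxwell_coords w = theta_mult (embed s)"
  shows "embed s = smul (s T0 T0 T0) (coords 1) + (smul (s T1 T0 T0) (coords ga) + (smul (s T0 T1 T0) (coords gb)
    + (smul (s T0 T0 T1) (coords gc) + smul (s T2 T0 T0) (coords gd))))"
proof -
  have M: "Maxwell_coords w Fa m n k = s m n k" "Maxwell_coords w Fb m n k = 0" "Maxwell_coords w Fc m n k = 0" "Maxwell_coords w Fd m n k = s m n k"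
    for m n k
    by (simp_all add: assms theta_mult_def embed_def)
  note f = codiff_coords_functionals[of "ext_d_coords 1 w", folded Maxwell_coords_def, unfolded M]
  note g = Maxwell_coords_functionals[of w, unfolded M]
  have cancel: "x = 0" if "c * x = 0" "c \<noteq> 0" for c x :: complex
    using that by simp
  have 1: "s T0 T2 T2 = 0"
    by (rule cancel[OF _ nonzero(1)]) (use f(1) in \<open>simp add: algebra_simps\<close>)
  have 2: "s T2 T2 T1 = 0"
    by (rule cancel[OF _ nonzero(5)]) (use f(3) in \<open>simp add: algebra_simps\<close>)
  have 3: "s T0 T1 T1 = 0"
    by (rule cancel[OF _ nonzero(2)]) (use f(4) in \<open>simp add: algebra_simps\<close>)
  have 4: "s T0 T1 T2 = 0"
    by (rule cancel[OF _ nonzero(2)]) (use f(5) in \<open>simp add: algebra_simps\<close>)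
  have 5: "s T0 T0 T2 = 0"
    by (rule cancel[OF _ nonzero(3)]) (use f(6) in \<open>simp add: algebra_simps\<close>)
  have 6: "s T0 T2 T1 = 0"
    by (rule cancel[OF _ nonzero(3)]) (use f(7) in \<open>simp add: algebra_simps\<close>)
  have 7: "s T0 T2 T0 = 0"
    by (rule cancel[OF _ nonzero(2)]) (use f(8) in \<open>simp add: algebra_simps\<close>)
  have 8: "s T1 T1 T1 = 0"
    by (rule cancel[OF _ nonzero(4)]) (use f(9) in \<open>simp add: algebra_simps\<close>)
  have 9: "s T1 T2 T2 = 0"
    by (rule cancel[OF _ nonzero(3)]) (use f(11) in \<open>simp add: algebra_simps\<close>)
  have 10: "s T2 T1 T2 = 0"
    by (rule cancel[OF _ nonzero(3)]) (use f(13) in \<open>simp add: algebra_simps\<close>)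
  have 11: "s T2 T2 T2 = 0"
    by (rule cancel[OF _ nonzero(4)]) (use f(14) in \<open>simp add: algebra_simps\<close>)
  have 12: "s T1 T0 T2 = 0" "s T2 T2 T0 = 0" "s T2 T0 T2 = 0" "s T1 T2 T0 = 0" "s T1 T1 T2 = 0" "s T1 T2 T1 = 0"
    using g q_nz by simp_all
  have 13: "s T2 T1 T0 = 0" "s T2 T0 T1 = 0"
    using g(5,6) q_nz by (simp_all add: 2 10)
  have 14: "s T1 T0 T1 = 0"
    by (rule cancel[OF _ nonzero(2)]) (use f(2) in \<open>simp add: algebra_simps 12\<close>)
  have 15: "s T1 T1 T0 = 0"
    by (rule cancel[OF _ nonzero(2)]) (use f(10) in \<open>simp add: algebra_simps 12\<close>)
  \<comment> \<open>The one equation that couples two surviving coordinates. Since d has coordinates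
    1 at a^2 and -1 - q at a^2 bc, it says that this pair is a multiple of d.\<close>
  have "(1 - q) * (s T2 T1 T1 - (- 1 - q) * s T2 T0 T0) = 0"
    using f(12) by (simp add: qring)
  then have 16: "s T2 T1 T1 = (- 1 - q) * s T2 T0 T0"
    using cancel nonzero(4) by (metis right_minus_eq)
  show ?thesis
    unfolding coords_gens
    by (rule tensor_eqI, rename_tac I m n k, case_tac "I = F1"; case_tac m; case_tac n; case_tac k;
      simp add: embed_def unit_apply 1 2 3 4 5 6 7 8 9 10 11 12 13 14 15 16)
qed

interpretation Om: ring "Omega q"
  by (rule ring_Omega)

section \<open>Spans over the scalars and the basis of valid sources\<close>

primrec span_free :: "free list \<Rightarrow> free set" where
  "span_free [] = {0}"
| "span_free (x # xs) = {cst z * x + y | z y. y \<in> span_free xs}"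

text \<open>\<open>Span\<close> adjoins one line at a time, and \<open>span_free\<close> copies this
  recursion on representatives.\<close>

lemma Span_cls: "Om.Span (scalars q) (map (cls q) xs) = cls q ` span_free xs"
proof (induction xs)
  case Nil
  then show ?case
    by (simp add: cls_zero)
next
  case (Cons x xs)
  have "Om.Span (scalars q) (map (cls q) (x # xs)) =
      {k \<otimes>\<^bsub>Omega q\<^esub> cls q x \<oplus>\<^bsub>Omega q\<^esub> v | k v. k \<in> scalars q \<and> v \<in> cls q ` span_free xs}"
    using Cons.IH by (auto simp: Om.line_extension_def r_coset_def set_add_def')
  also have "\<dots> = cls q ` span_free (x # xs)"
  proof -
    have "cls q (cst z * x + y) = cls q (cst z) \<otimes>\<^bsub>Omega q\<^esub> cls q x \<oplus>\<^bsub>Omega q\<^esub> cls q y" for z y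
      by (simp add: cls_mult cls_add)
    then show ?thesis
      by (auto simp: scalars_def) blast+
  qed
  finally show ?case .
qed

abbreviation sources :: "free list" where
  "sources \<equiv> [theta, theta * ga, theta * gb, theta * gc, theta * gd]"

lemma span_free_Cons: "y \<in> span_free xs \<Longrightarrow> cst z * x + y \<in> span_free (x # xs)"
  by auto

lemma in_span_sources: "x \<in> span_free sources \<longleftrightarrow> (\<exists>z1 z2 z3 z4 z5. x = cst z1 * theta + (cst z2 * (theta * ga) +
   (cst z3 * (theta * gb) + (cst z4 * (theta * gc) + (cst z5 * (theta * gd) + 0)))))" (is "_ = ?R")
proof
  assume ?R
  then show "x \<in> span_free sources"
    by (elim exE) (simp only: span_free_Cons span_free.simps(1) singletonI)
next
  assume "x \<in> span_free sources"
  then obtain z1 z2 z3 z4 z5 where "x = cst z1 * theta + (cst z2 * (theta * ga) +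
    (cst z3 * (theta * gb) + (cst z4 * (theta * gc) + (cst z5 * (theta * gd) + 0))))"
    by auto
  then show ?R by blast
qed

lemma coords_sources:
  "coords (cst z1 * theta + (cst z2 * (theta * ga) + (cst z3 * (theta * gb) + (cst z4 * (theta * gc) +
     (cst z5 * (theta * gd) + 0))))) = theta_mult (smul z1 (coords 1) + (smul z2 (coords ga) + (smul z3 (coords gb)
     + (smul z4 (coords gc) + smul z5 (coords gd)))))"
proof -
  have "coords theta = theta_mult (coords 1)"
    using coords_theta_mult[of 1] by simp
  then show ?thesis
    by (simp only: coords_simps coords_theta_mult lin_theta_mult[THEN lin_add] lin_theta_mult[THEN lin_smul] add_0_right)
qed

lemma valid_sources_eq: "valid_theta_sources q = Om.Span (scalars q) (map (cls q) sources)"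
proof (intro equalityI subsetI)
  fix X assume "X \<in> valid_theta_sources q"
  then obtain F W where X: "X = cls q theta \<otimes>\<^bsub>Omega q\<^esub> F" and F: "F \<in> calA q"
    and w: "X = Maxwell q W" and W: "W \<in> Omega_deg q 1"
    unfolding valid_theta_sources_def by blast
  from F obtain f where f: "homogeneous 0 f" "F = cls q f"
    unfolding Omega_deg_def homogeneous_def by blast
  from W obtain w where W: "W = form_of w"
    unfolding Omega_deg_eq by blast
  note w = w[unfolded W] and X = X[unfolded f cls_mult] and f = f(1)
  define s where "s = coords f F1"
  have s: "coords f = embed s"
    using has_deg_coords[OF f] by (auto simp: has_deg_iff all_form s_def embed_def fun_eq_iff)
  have "Maxwell_coords w = theta_mult (embed s)"
    using X w by (simp add: Maxwell_form_of coords_theta_mult s form_of_eq_iff flip: form_of_coords)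
  note valid_source_coeffs[OF this]
  then have "coords (theta * f) = coords (cst (s T0 T0 T0) * theta + (cst (s T1 T0 T0) * (theta * ga) +
      (cst (s T0 T1 T0) * (theta * gb) + (cst (s T0 T0 T1) * (theta * gc) + (cst (s T2 T0 T0) * (theta * gd) + 0)))))"
    unfolding coords_sources coords_theta_mult s by simp
  then show "X \<in> Om.Span (scalars q) (map (cls q) sources)"
    unfolding Span_cls X cls_coords[symmetric] image_iff by (metis in_span_sources)
next
  fix X assume "X \<in> Om.Span (scalars q) (map (cls q) sources)"
  then obtain x where x: "x \<in> span_free sources" "X = cls q x"
    unfolding Span_cls by blast
  from x(1) obtain z1 z2 z3 z4 z5 where z: "x = cst z1 * theta + (cst z2 * (theta * ga) +
      (cst z3 * (theta * gb) + (cst z4 * (theta * gc) + (cst z5 * (theta * gd) + 0))))"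
    unfolding in_span_sources by blast
  note X = x(2)[unfolded z]
  define f where "f = cst z1 * 1 + (cst z2 * ga + (cst z3 * gb + (cst z4 * gc + cst z5 * gd)))"
  define w where "w = smul z1 (smul (1 / 12) field_1) + (smul z2 (smul (1 / 12) field_a)
    + (smul z3 (smul (1 / 12) field_b) + (smul z4 (smul (1 / 12) field_c) + smul z5 (smul (1 / 12) field_d))))"
  have "homogeneous 0 f"
    unfolding f_def by (intro homogeneous_add homogeneous_mult_0 homogeneous_cst homogeneous_var)
  moreover have "X = cls q theta \<otimes>\<^bsub>Omega q\<^esub> cls q f"
    unfolding X cls_mult cls_coords coords_sources coords_theta_mult f_def
    by (simp only: coords_simps)
  moreover have "Maxwell_coords w = theta_mult (smul z1 (coords 1) + (smul z2 (coords ga) + (smul z3 (coords gb)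
     + (smul z4 (coords gc) + smul z5 (coords gd)))))"
    unfolding w_def lin_Maxwell_coords[THEN lin_add] lin_Maxwell_coords[THEN lin_smul, of z1] lin_Maxwell_coords[THEN lin_smul, of z2]
      lin_Maxwell_coords[THEN lin_smul, of z3] lin_Maxwell_coords[THEN lin_smul, of z4] lin_Maxwell_coords[THEN lin_smul, of z5] Maxwell_coords_field
      lin_theta_mult[THEN lin_add] lin_theta_mult[THEN lin_smul] ..
  then have "X = Maxwell q (form_of w)"
    unfolding Maxwell_form_of X form_of_coords[symmetric] form_of_eq_iff coords_sources by simp
  moreover have "has_deg 1 w"
    unfolding w_def by (intro has_deg_linear has_deg_field)
  then have "form_of w \<in> Omega_deg q 1"
    unfolding Omega_deg_eq by (intro imageI CollectI)
  ultimately show "X \<in> valid_theta_sources q"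
    unfolding valid_theta_sources_def using calA_cls by blast
qed

text \<open>Each source is separated from the later ones by its e_a coordinate at a single monomial,
  in turn 1, a, b, c and a^2, which occurs in none of the later sources.\<close>

lemma independent_sources: "Om.independent (scalars q) (map (cls q) sources)"
proof -
  have theta: "coords theta = theta_mult (coords 1)"
    using coords_theta_mult[of 1] by simp
  have neq: "cls q x \<notin> Om.Span (scalars q) (map (cls q) xs)"
    if "\<And>y. y \<in> span_free xs \<Longrightarrow> coords x \<noteq> coords y" for x xs
    using that unfolding Span_cls by (auto simp: cls_coords)
  note rules = theta_mult_def coords_gens unit_apply coords_theta_mult coords_simps
  have zero: "coords 0 = 0"
    by (simp add: coords_def act_zero)
  show ?thesis
    unfolding list.map
  proof (intro Om.li_Cons Om.li_Nil cls_carrier)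
    show "cls q (theta) \<notin> Om.Span (scalars q) [cls q (theta * ga), cls q (theta * gb), cls q (theta * gc), cls q (theta * gd)]"
    proof (rule neq[of "[theta * ga, theta * gb, theta * gc, theta * gd]", unfolded list.map], rule notI)
      fix y assume "y \<in> span_free [theta * ga, theta * gb, theta * gc, theta * gd]" "coords (theta) = coords y"
      then obtain z1 z2 z3 z4 where "coords (theta) = coords (cst z1 * (theta * ga) + (cst z2 * (theta * gb) + (cst z3 * (theta * gc) + (cst z4 * (theta * gd) + 0))))"
        by auto
      then have "theta_mult (coords 1) Fa T0 T0 T0 = coords (cst z1 * (theta * ga) + (cst z2 * (theta * gb) + (cst z3 * (theta * gc) + (cst z4 * (theta * gd) + 0)))) Fa T0 T0 T0"
        by (simp add: theta)
      then show False
        by (simp add: rules zero)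
    qed
    show "cls q (theta * ga) \<notin> Om.Span (scalars q) [cls q (theta * gb), cls q (theta * gc), cls q (theta * gd)]"
    proof (rule neq[of "[theta * gb, theta * gc, theta * gd]", unfolded list.map], rule notI)
      fix y assume "y \<in> span_free [theta * gb, theta * gc, theta * gd]" "coords (theta * ga) = coords y"
      then obtain z2 z3 z4 where "coords (theta * ga) = coords (cst z2 * (theta * gb) + (cst z3 * (theta * gc) + (cst z4 * (theta * gd) + 0)))"
        by auto
      then have "coords (theta * ga) Fa T1 T0 T0 = coords (cst z2 * (theta * gb) + (cst z3 * (theta * gc) + (cst z4 * (theta * gd) + 0))) Fa T1 T0 T0"
        by simp
      then show False
        by (simp add: rules zero)
    qed
    show "cls q (theta * gb) \<notin> Om.Span (scalars q) [cls q (theta * gc), cls q (theta * gd)]"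
    proof (rule neq[of "[theta * gc, theta * gd]", unfolded list.map], rule notI)
      fix y assume "y \<in> span_free [theta * gc, theta * gd]" "coords (theta * gb) = coords y"
      then obtain z3 z4 where "coords (theta * gb) = coords (cst z3 * (theta * gc) + (cst z4 * (theta * gd) + 0))"
        by auto
      then have "coords (theta * gb) Fa T0 T1 T0 = coords (cst z3 * (theta * gc) + (cst z4 * (theta * gd) + 0)) Fa T0 T1 T0"
        by simp
      then show False
        by (simp add: rules zero)
    qed
    show "cls q (theta * gc) \<notin> Om.Span (scalars q) [cls q (theta * gd)]"
    proof (rule neq[of "[theta * gd]", unfolded list.map], rule notI)
      fix y assume "y \<in> span_free [theta * gd]" "coords (theta * gc) = coords y"
      then obtain z4 where "coords (theta * gc) = coords (cst z4 * (theta * gd) + 0)"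
        by auto
      then have "coords (theta * gc) Fa T0 T0 T1 = coords (cst z4 * (theta * gd) + 0) Fa T0 T0 T1"
        by simp
      then show False
        by (simp add: rules zero)
    qed
    show "cls q (theta * gd) \<notin> Om.Span (scalars q) []"
    proof (rule neq[of "[]", unfolded list.map], rule notI)
      fix y assume "y \<in> span_free []" "coords (theta * gd) = coords y"
      then have "coords (theta * gd) Fa T2 T0 T0 = coords 0 Fa T2 T0 T0"
        by simp
      then show False
        by (simp add: rules zero)
    qed
  qed
qed

section \<open>The gauge field of \<theta>, its curvature and all solutions\<close>

lemma coords_gauge:
  "coords (- cst (q ^ 2 * t) * theta * gb * gc * (1 + gb * gc) - cst (q * mu q * t) * (ea + ec * ga ^ 2 * gc)) =
   smul t field_1"
  unfolding field_1_def
  by (simp add: act_unit mult.assoc mu power2_eq_square, rule tensor_eqI, simp add: qring)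

text \<open>As in the previous lemma, t stands for 1/12 and keeps denominators out of the
  comparison; then 3 q t = q/4.\<close>

lemma coords_curvature:
  "coords (- cst (3 * q * t) * ea * ed + cst (mu q * t) * ((ea * eb - eb * ed) * gd ^ 2 * gb
      - cst q * (ec * ed - ea * ec) * ga ^ 2 * gc)) = smul t curv_1"
  unfolding curv_1_def
  by (simp add: act_unit mult.assoc mu power2_eq_square, rule tensor_eqI, simp add: qring)

lemma gauge_field_eq: "gauge_field q = form_of (smul (1 / 12) field_1)"
  using coords_gauge[of "1 / 12"] by (simp add: gauge_field_def flip: form_of_coords)

lemma curvature_eq: "curvature q = form_of (smul (1 / 12) curv_1)"
  using coords_curvature[of "1 / 12"] by (simp add: curvature_def flip: form_of_coords)

lemma codiff_coords_field_1: "codiff_coords 1 field_1 = 0"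
  unfolding field_1_def codiff_coords_def ext_d_coords_def
  by (simp add: ext_d_unit_simps, rule tensor_eqI, simp add: qring)

text \<open>The 1-form e_a c is the nonzero kernel element that later witnesses non-uniqueness of
  the gauge field.\<close>

lemma Maxwell_coords_ker: "Maxwell_coords (wedge_a (unit T0 T0 T1)) = 0"
  unfolding Maxwell_coords_def codiff_coords_def ext_d_coords_def
  by (simp add: ext_d_unit_simps, rule tensor_eqI, simp add: qring)

lemma gauge_theorem:
  "gauge_field q \<in> Omega_deg q 1"
  "Maxwell q (gauge_field q) = cls q theta"
  "codiff q 1 (gauge_field q) = \<zero>\<^bsub>Omega q\<^esub>"
  "ext_d q 1 (gauge_field q) = curvature q"
proof -
  have theta: "theta_mult (coords 1) = coords theta"
    using coords_theta_mult[of 1] by simp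
  show "gauge_field q \<in> Omega_deg q 1"
    unfolding gauge_field_eq Omega_deg_eq by (intro imageI CollectI has_deg_linear has_deg_field)
  show "Maxwell q (gauge_field q) = cls q theta"
    unfolding gauge_field_eq Maxwell_form_of Maxwell_coords_field theta form_of_coords ..
  have "form_of 0 = cls q 0"
    by (simp add: form_of_def iota_zero)
  then show "codiff q 1 (gauge_field q) = \<zero>\<^bsub>Omega q\<^esub>"
    unfolding gauge_field_eq codiff_form_of lin_codiff_coords[THEN lin_smul] codiff_coords_field_1 cls_zero by simp
  show "ext_d q 1 (gauge_field q) = curvature q"
    unfolding gauge_field_eq curvature_eq ext_d_form_of lin_ext_d_coords[THEN lin_smul] curv_1 ..
qed

lemma gauge_solutions:
  "{B \<in> Omega_deg q 1. Maxwell q B = cls q theta} =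
     {gauge_field q \<oplus>\<^bsub>Omega q\<^esub> K | K. K \<in> Omega_deg q 1 \<and> Maxwell q K = \<zero>\<^bsub>Omega q\<^esub>}"
proof -
  let ?g = "smul (1 / 12) field_1"
  have g: "has_deg 1 ?g" "Maxwell_coords ?g = coords theta"
    using gauge_theorem(1,2) coords_theta_mult[of 1]
    by (simp_all only: has_deg_linear has_deg_field Maxwell_coords_field mult_1_right)
  have zero: "\<zero>\<^bsub>Omega q\<^esub> = form_of 0"
    by (simp add: form_of_def iota_zero cls_zero)
  have diff: "has_deg 1 (w - ?g)" "Maxwell_coords (w - ?g) = Maxwell_coords w - coords theta" if "has_deg 1 w" for w
    using has_deg_linear(1)[OF that has_deg_linear(2)[OF g(1), of "- 1"]] lin_Maxwell_coords[THEN lin_diff, of w ?g]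
    by (simp_all only: smul_minus diff_conv_add_uminus g(2))
  show ?thesis
  proof (intro equalityI subsetI; elim CollectE conjE exE)
    fix B assume "B \<in> Omega_deg q 1" and B: "Maxwell q B = cls q theta"
    then obtain w where w: "has_deg 1 w" "B = form_of w"
      by (auto simp: Omega_deg_eq)
    with B have "Maxwell_coords w = coords theta"
      by (simp only: Maxwell_form_of form_of_coords[symmetric] form_of_eq_iff)
    with diff[OF w(1)] have "form_of (w - ?g) \<in> Omega_deg q 1" "Maxwell q (form_of (w - ?g)) = \<zero>\<^bsub>Omega q\<^esub>"
      by (simp_all add: Omega_deg_eq Maxwell_form_of zero)
    moreover have "B = gauge_field q \<oplus>\<^bsub>Omega q\<^esub> form_of (w - ?g)"
      unfolding w gauge_field_eq form_of_add[symmetric] by simp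
    ultimately show "B \<in> {gauge_field q \<oplus>\<^bsub>Omega q\<^esub> K | K. K \<in> Omega_deg q 1 \<and> Maxwell q K = \<zero>\<^bsub>Omega q\<^esub>}"
      by blast
  next
    fix B K assume B: "B = gauge_field q \<oplus>\<^bsub>Omega q\<^esub> K" and "K \<in> Omega_deg q 1"
      and K: "Maxwell q K = \<zero>\<^bsub>Omega q\<^esub>"
    then obtain w where w: "has_deg 1 w" "K = form_of w"
      by (auto simp: Omega_deg_eq)
    with K have "Maxwell_coords w = 0"
      by (simp only: Maxwell_form_of zero form_of_eq_iff)
    then have "Maxwell_coords (?g + w) = coords theta"
      by (simp only: lin_Maxwell_coords[THEN lin_add] g add_0_right)
    moreover have "B = form_of (?g + w)"
      by (simp only: B w gauge_field_eq form_of_add)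
    moreover have "has_deg 1 (?g + w)"
      by (intro has_deg_linear g w)
    ultimately show "B \<in> {B \<in> Omega_deg q 1. Maxwell q B = cls q theta}"
      by (simp add: Omega_deg_eq Maxwell_form_of form_of_coords)
  qed
qed

lemma gauge_not_unique:
  "\<exists>B \<in> Omega_deg q 1. B \<noteq> gauge_field q \<and> Maxwell q B = cls q theta"
proof -
  let ?k = "wedge_a (unit T0 T0 T1)"
  have k: "has_deg 1 ?k"
    by (simp add: has_deg_iff all_form fun_eq_iff unit_apply)
  have "?k Fa T0 T0 T1 \<noteq> 0"
    by (simp add: unit_apply)
  then have nz: "?k \<noteq> 0"
    by (metis zero_fun_apply)
  have zero: "\<zero>\<^bsub>Omega q\<^esub> = form_of 0"
    by (simp add: form_of_def iota_zero cls_zero)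
  have "form_of ?k \<in> Omega_deg q 1" "Maxwell q (form_of ?k) = \<zero>\<^bsub>Omega q\<^esub>"
    using k by (simp_all only: Omega_deg_eq imageI mem_Collect_eq Maxwell_form_of Maxwell_coords_ker zero)
  then have "gauge_field q \<oplus>\<^bsub>Omega q\<^esub> form_of ?k \<in> {B \<in> Omega_deg q 1. Maxwell q B = cls q theta}"
    unfolding gauge_solutions by blast
  moreover have "gauge_field q \<oplus>\<^bsub>Omega q\<^esub> form_of ?k \<noteq> gauge_field q"
    using nz by (simp only: gauge_field_eq form_of_add[symmetric] form_of_eq_iff add_cancel_left_right not_False_eq_True)
  ultimately show ?thesis
    by blast
qed

lemma valid_sources_basis:
  "is_basis_of q
     [cls q theta, cls q (theta * ga), cls q (theta * gb), cls q (theta * gc), cls q (theta * gd)]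
     (valid_theta_sources q)"
  "cls q theta \<in> valid_theta_sources q"
proof -
  show "is_basis_of q
     [cls q theta, cls q (theta * ga), cls q (theta * gb), cls q (theta * gc), cls q (theta * gd)]
     (valid_theta_sources q)"
    unfolding is_basis_of_def valid_sources_eq using independent_sources by simp
  have "cls q theta = cls q theta \<otimes>\<^bsub>Omega q\<^esub> cls q 1"
    by (simp add: cls_mult)
  then show "cls q theta \<in> valid_theta_sources q"
    unfolding valid_theta_sources_def using calA_cls[OF homogeneous_cst(2)] gauge_theorem(1,2)
    by (metis (mono_tags, lifting) IntI image_eqI mem_Collect_eq)
qed

end

theorem proposition4p9:
  fixes q :: complex
  assumes "q ^ 3 = 1" and "q \<noteq> 1"
  shows "is_basis_of q
           [cls q theta, cls q (theta * ga), cls q (theta * gb), cls q (theta * gc),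
            cls q (theta * gd)]
           (valid_theta_sources q) \<and>
         cls q theta \<in> valid_theta_sources q \<and>
         gauge_field q \<in> Omega_deg q 1 \<and>
         Maxwell q (gauge_field q) = cls q theta \<and>
         codiff q 1 (gauge_field q) = \<zero>\<^bsub>Omega q\<^esub> \<and>
         {B \<in> Omega_deg q 1. Maxwell q B = cls q theta} =
           {gauge_field q \<oplus>\<^bsub>Omega q\<^esub> K | K. K \<in> Omega_deg q 1 \<and> Maxwell q K = \<zero>\<^bsub>Omega q\<^esub>} \<and>
         (\<exists>B \<in> Omega_deg q 1. B \<noteq> gauge_field q \<and> Maxwell q B = cls q theta) \<and>
         ext_d q 1 (gauge_field q) = curvature q"
proof -
  interpret cube_root q
    by unfold_locales (rule assms)+
  show ?thesis
    by (intro conjI valid_sources_basis gauge_theorem gauge_solutions gauge_not_unique)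
qed

end
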